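(* For any positive integer $d$ and any integer $m$ with $2\le m\le 15$, define for $0\le i\le d$ \[ f_m(d,i)=\sum_{h=0}^{m-1}\frac{1}{(m-h)\binom{m}{h}}\binom{i+m}{m-h-1}\binom{i-1+h}{h}\binom{d-i+h}{h}. \] Then the sequence $\{f_m(d,i)\}_{i=0}^{d}$ is a $d$-sequence.
   Context: Binomial coefficients are $\binom{x}{h}=x(x-1)\cdots(x-h+1)/h!$ for integers $h\ge 0$ (so $\binom{-1}{0}=1$). A finite sequence $\Gamma=\{\gamma_k\}_{k=0}^{n}$ of real numbers is an $n$-sequence if for every real polynomial $f(t)=\sum_{k=0}^{n}a_kt^k$ of degree at most $n$ having only real zeros, the polynomial $\Gamma[f(t)]=\sum_{k=0}^{n}\gamma_k a_k t^k$ also has only real zeros. *)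

theory Defs
  imports Complex_Main "HOL-Computational_Algebra.Polynomial"
begin

(* Zeros are taken in the complex plane; the zero polynomial, which vanishes
   everywhere, does not satisfy this predicate. *)
definition only_real_zeros :: "real poly \<Rightarrow> bool" where
  "only_real_zeros p \<longleftrightarrow>
     (\<forall>z::complex. poly (map_poly complex_of_real p) z = 0 \<longrightarrow> z \<in> \<real>)"

definition diag_op :: "nat \<Rightarrow> (nat \<Rightarrow> real) \<Rightarrow> real poly \<Rightarrow> real poly" where
  "diag_op n \<gamma> p = (\<Sum>k\<le>n. monom (\<gamma> k * coeff p k) k)"

(* Only the values of the sequence at 0, ..., n matter. *)
definition n_sequence :: "nat \<Rightarrow> (nat \<Rightarrow> real) \<Rightarrow> bool" where
  "n_sequence n \<gamma> \<longleftrightarrow>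
     (\<forall>p. degree p \<le> n \<longrightarrow> only_real_zeros p \<longrightarrow> only_real_zeros (diag_op n \<gamma> p))"

(* The upper arguments are real, so that i - 1 + h is -1 (and the coefficient is 1)
   for i = h = 0. *)
definition f_seq :: "nat \<Rightarrow> nat \<Rightarrow> nat \<Rightarrow> real" where
  "f_seq m d i =
     (\<Sum>h = 0..m - 1.
        1 / ((real m - real h) * (real m gchoose h))
        * ((real i + real m) gchoose (m - h - 1))
        * ((real i - 1 + real h) gchoose h)
        * ((real d - real i + real h) gchoose h))"

end

theory Submission
  imports Defs "HOL-Computational_Algebra.Fundamental_Theorem_Algebra"
begin

text \<open>
  By Szego's composition theorem a positive sequence \<open>\<gamma>\<close> is a \<open>d\<close>-sequence as soon as
  \<open>\<Sum>i\<le>d. (d choose i) \<gamma>\<^sub>i t\<^sup>i\<close> splits into linear factors with negative zeros. In particular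
  products of \<open>d\<close>-sequences which are linear in \<open>j = d - i\<close>, with zero outside \<open>[0, d]\<close>, are
  \<open>d\<close>-sequences, and so is \<open>j (j - 1) + B j + g\<close> if \<open>B, g > 0\<close> and \<open>B\<^sup>2 \<ge> 4 g\<close>.

  For fixed \<open>d\<close> the term \<open>f\<^sub>m(d, i)\<close> is a polynomial of degree \<open>2 m - 2\<close> in \<open>j\<close>. Its signs at
  \<open>j = d, d + 1, \<dots>, d + m - 1\<close> alternate, which gives \<open>m - 1\<close> zeros beyond \<open>d\<close>. For \<open>d\<close> above a
  threshold depending on \<open>m\<close>, its signs at \<open>-7/2, -9/2, \<dots>, -m - 1/2\<close> alternate as well, and the
  remaining two zeros form a possibly non-real pair near \<open>-5/2\<close>. Every other zero \<open>r\<close> satisfies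
  \<open>0 < (-3/2 - r) (-7/2 - r) \<le> (-5/2 - r)\<^sup>2\<close>, so that comparing the values at \<open>-3/2, -5/2, -7/2\<close> puts
  this pair into the region where its quadratic factor is a \<open>d\<close>-sequence. The finitely many \<open>d\<close>
  below the threshold are settled by exhibiting sign changes of the binomial generating polynomial.
\<close>

subsection \<open>Szego composition\<close>

text \<open>After clearing denominators this compares the distances from \<open>y\<close> to
  \<open>2 * \<sigma> * \<i>\<close> and to 0; the perpendicular bisector of these two points is the
  line \<open>Im y = \<sigma>\<close>.\<close>

lemma norm_inverse_shift:
  fixes y :: complex
  assumes "y \<noteq> 0" "\<sigma> > 0"
  shows "cmod (1 / y + \<i> / (2 * \<sigma>)) \<le> 1 / (2 * \<sigma>) \<longleftrightarrow> Im y \<ge> \<sigma>"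
proof -
  have "1 / y + \<i> / (2 * \<sigma>) = (2 * \<sigma> + \<i> * y) / (2 * \<sigma> * y)"
    using assms by (simp add: field_simps)
  hence "cmod (1 / y + \<i> / (2 * \<sigma>)) = cmod (2 * \<sigma> + \<i> * y) / (2 * \<sigma> * cmod y)"
    using assms by (simp add: norm_divide norm_mult)
  hence eq: "cmod (1 / y + \<i> / (2 * \<sigma>)) = cmod (2 * \<sigma> + \<i> * y) / cmod y * (1 / (2 * \<sigma>))"
    by simp
  have "cmod (1 / y + \<i> / (2 * \<sigma>)) \<le> 1 / (2 * \<sigma>) \<longleftrightarrow> cmod (2 * \<sigma> + \<i> * y) \<le> cmod y"
    unfolding eq using assms by (simp add: divide_simps)
  also have "\<dots> \<longleftrightarrow> (cmod (2 * \<sigma> + \<i> * y))\<^sup>2 \<le> (cmod y)\<^sup>2"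
    by (simp add: abs_le_square_iff [symmetric])
  also have "\<dots> \<longleftrightarrow> 4 * \<sigma> * \<sigma> \<le> 4 * \<sigma> * Im y"
    unfolding cmod_power2 by (simp add: power2_eq_square algebra_simps)
  finally show ?thesis
    using assms by simp
qed

text \<open>The logarithmic derivative is the sum of the \<open>1 / (s - z)\<close>. Since
  \<open>Im (w * (s - z)) \<ge> Im (w * s)\<close>, each \<open>1 / (w * (s - z))\<close> lies in
  the disc of \<open>norm_inverse_shift\<close>, and a sum of \<open>size A\<close> points of a disc
  lies in that disc scaled by \<open>size A\<close>.\<close>

lemma log_deriv_in_disc:
  fixes A :: "complex multiset"
  assumes s: "Im (w * s) > 0" and A: "\<And>z. z \<in># A \<Longrightarrow> Im (w * z) \<le> 0"
  defines "P \<equiv> (\<Prod>z\<in>#A. [:-z, 1:])"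
  shows "poly P s \<noteq> 0 \<and>
    cmod (poly (pderiv P) s / (w * poly P s) + of_nat (size A) * (\<i> / (2 * Im (w * s))))
      \<le> of_nat (size A) / (2 * Im (w * s))"
  using A unfolding P_def
proof (induction A)
  case empty
  then show ?case by simp
next
  case (add z A)
  let ?Q = "\<Prod>z\<in>#A. [:-z, 1:]"
  let ?\<sigma> = "Im (w * s)"
  have IH: "poly ?Q s \<noteq> 0"
    "cmod (poly (pderiv ?Q) s / (w * poly ?Q s) + of_nat (size A) * (\<i> / (2 * ?\<sigma>)))
      \<le> of_nat (size A) / (2 * ?\<sigma>)"
    using add by auto
  have z: "Im (w * (s - z)) \<ge> ?\<sigma>"
    using add.prems[of z] by (simp add: algebra_simps)
  have w: "w \<noteq> 0" and nz: "w * (s - z) \<noteq> 0"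
    using z s by auto
  hence sz: "s - z \<noteq> 0" by auto
  have disc: "cmod (1 / (w * (s - z)) + \<i> / (2 * ?\<sigma>)) \<le> 1 / (2 * ?\<sigma>)"
    using norm_inverse_shift[OF nz s] z by simp
  have "poly (pderiv ([:-z, 1:] * ?Q)) s = poly ?Q s + (s - z) * poly (pderiv ?Q) s"
    by (simp only: pderiv_mult) (simp add: pderiv_pCons algebra_simps)
  moreover have "poly ([:-z, 1:] * ?Q) s = (s - z) * poly ?Q s"
    by (simp add: algebra_simps)
  ultimately have "poly (pderiv ([:-z, 1:] * ?Q)) s / (w * poly ([:-z, 1:] * ?Q) s)
      = 1 / (w * (s - z)) + poly (pderiv ?Q) s / (w * poly ?Q s)"
    using IH(1) sz w by (simp add: divide_simps)
  hence "poly (pderiv ([:-z, 1:] * ?Q)) s / (w * poly ([:-z, 1:] * ?Q) s)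
        + of_nat (size (add_mset z A)) * (\<i> / (2 * ?\<sigma>))
      = (1 / (w * (s - z)) + \<i> / (2 * ?\<sigma>))
        + (poly (pderiv ?Q) s / (w * poly ?Q s) + of_nat (size A) * (\<i> / (2 * ?\<sigma>)))"
    by (simp add: algebra_simps add_divide_distrib)
  also have "cmod \<dots> \<le> 1 / (2 * ?\<sigma>) + of_nat (size A) / (2 * ?\<sigma>)"
    using disc IH(2) by (rule norm_triangle_mono)
  also have "\<dots> = of_nat (size (add_mset z A)) / (2 * ?\<sigma>)"
    by (simp add: add_divide_distrib)
  finally show ?case
    using IH(1) sz by simp
qed

text \<open>If the expression vanished, the logarithmic derivative of \<open>q\<close> at
  \<open>s\<close> would be \<open>n / (s - \<zeta>)\<close>. The disc estimate, read backwards,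
  would then give \<open>Im (w * (s - \<zeta>)) \<ge> Im (w * s)\<close> and push the pole
  \<open>\<zeta>\<close> out of the zero-free half-plane.\<close>

lemma polar_derivative_nonzero:
  fixes q :: "complex poly"
  assumes deg: "degree q \<le> n" and n: "n > 0"
    and nz: "\<And>s. Im (w * s) > 0 \<Longrightarrow> poly q s \<noteq> 0"
    and s: "Im (w * s) > 0" and \<zeta>: "Im (w * \<zeta>) > 0"
  shows "of_nat n * poly q s - (s - \<zeta>) * poly (pderiv q) s \<noteq> 0"
proof
  assume eq: "of_nat n * poly q s - (s - \<zeta>) * poly (pderiv q) s = 0"
  define \<sigma> where "\<sigma> = Im (w * s)"
  have \<sigma>: "\<sigma> > 0" using s by (simp add: \<sigma>_def)
  have qs: "poly q s \<noteq> 0" using nz s by blast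
  hence q0: "q \<noteq> 0" by auto
  obtain A where A: "smult (lead_coeff q) (\<Prod>z\<in>#A. [:-z, 1:]) = q" "size A = degree q"
    using complex_poly_decompose_multiset[of q] size_proots_complex[of q] by metis
  define P where "P = (\<Prod>z\<in>#A. [:-z, 1:])"
  have qP: "q = smult (lead_coeff q) P" using A by (simp add: P_def)
  have root: "Im (w * z) \<le> 0" if "z \<in># A" for z
  proof -
    have "poly P z = 0"
      using that by (auto simp: P_def poly_prod_mset)
    hence "poly q z = 0" by (subst qP) simp
    thus ?thesis using nz[of z] by force
  qed
  have w: "w \<noteq> 0" using s by auto
  have s\<zeta>: "s \<noteq> \<zeta>" using eq qs n by auto
  hence y: "w * (s - \<zeta>) \<noteq> 0" using w by simp
  have lc: "lead_coeff q \<noteq> 0" using q0 by simp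
  have rat: "poly (pderiv P) s / (w * poly P s) = poly (pderiv q) s / (w * poly q s)"
  proof -
    have "poly q s = lead_coeff q * poly P s" "poly (pderiv q) s = lead_coeff q * poly (pderiv P) s"
      by (subst qP, simp add: pderiv_smult)+
    thus ?thesis using lc by simp
  qed
  also have "\<dots> = of_nat n * (1 / (w * (s - \<zeta>)))"
  proof -
    have "poly (pderiv q) s = of_nat n * poly q s / (s - \<zeta>)"
      using eq s\<zeta> by (simp add: field_simps)
    thus ?thesis using qs by simp
  qed
  finally have ld: "poly (pderiv P) s / (w * poly P s) = of_nat n * (1 / (w * (s - \<zeta>)))" .
  have "cmod (of_nat n * (1 / (w * (s - \<zeta>))) + of_nat (degree q) * (\<i> / (2 * \<sigma>)))
      \<le> of_nat (degree q) / (2 * \<sigma>)"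
    using log_deriv_in_disc[of w s A, OF s root, folded P_def \<sigma>_def, unfolded A(2) ld] by blast
  \<comment> \<open>If \<open>degree q < n\<close>, the missing zeros count as zeros at infinity:
    each contributes 0, a boundary point of the disc.\<close>
  moreover have "cmod (of_nat (n - degree q) * (\<i> / (2 * \<sigma>))) = of_nat (n - degree q) / (2 * \<sigma>)"
    using \<sigma> by (simp add: norm_mult norm_divide)
  ultimately have "cmod ((of_nat n * (1 / (w * (s - \<zeta>))) + of_nat (degree q) * (\<i> / (2 * \<sigma>)))
      + of_nat (n - degree q) * (\<i> / (2 * \<sigma>)))
      \<le> of_nat (degree q) / (2 * \<sigma>) + of_nat (n - degree q) / (2 * \<sigma>)"
    by (intro norm_triangle_mono) auto
  also have "\<dots> = of_nat n * (1 / (2 * \<sigma>))"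
    using deg by (simp add: of_nat_diff add_divide_distrib [symmetric])
  also have "(of_nat n * (1 / (w * (s - \<zeta>))) + of_nat (degree q) * (\<i> / (2 * \<sigma>)))
      + of_nat (n - degree q) * (\<i> / (2 * \<sigma>)) = of_nat n * (1 / (w * (s - \<zeta>)) + \<i> / (2 * \<sigma>))"
    using deg by (simp add: of_nat_diff algebra_simps add_divide_distrib diff_divide_distrib)
  finally have "real n * cmod (1 / (w * (s - \<zeta>)) + \<i> / (2 * \<sigma>)) \<le> real n * (1 / (2 * \<sigma>))"
    by (simp only: norm_mult norm_of_nat)
  hence "cmod (1 / (w * (s - \<zeta>)) + \<i> / (2 * \<sigma>)) \<le> 1 / (2 * \<sigma>)"
    by (rule mult_left_le_imp_le) (use n in simp)
  hence "Im (w * (s - \<zeta>)) \<ge> \<sigma>"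
    using norm_inverse_shift[OF y \<sigma>] by simp
  thus False using \<zeta> by (simp add: \<sigma>_def algebra_simps)
qed

section \<open>Iterated polar derivatives and the apolar pairing\<close>

text \<open>This is \<open>r\<close> times the polar derivative of \<open>q\<close> with pole
  \<open>1 / r\<close> and nominal degree \<open>n\<close>. The scaling makes the factors
  \<open>[:r, 1:]\<close> appear in \<open>polar_iter_eq_sum\<close>.\<close>

definition polar :: "nat \<Rightarrow> real \<Rightarrow> complex poly \<Rightarrow> complex poly" where
  "polar n r q = pderiv q + smult (of_real r) (smult (of_nat n) q - pCons 0 (pderiv q))"

lemma coeff_polar:
  "coeff (polar n r q) i =
     of_nat (Suc i) * coeff q (Suc i) + of_real r * (of_nat n - of_nat i) * coeff q i"
  by (cases i) (simp_all add: polar_def coeff_pderiv coeff_pCons algebra_simps)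

lemma degree_polar:
  assumes "degree q \<le> Suc n"
  shows "degree (polar (Suc n) r q) \<le> n"
proof (rule degree_le, intro allI impI)
  fix i assume "n < i"
  with assms show "coeff (polar (Suc n) r q) i = 0"
    by (cases "i = Suc n") (simp_all add: coeff_polar coeff_eq_0)
qed

text \<open>The nominal degree is the number of poles left, so a \<open>q\<close> of at most that
  degree ends as a constant.\<close>

fun polar_iter :: "real list \<Rightarrow> complex poly \<Rightarrow> complex" where
  "polar_iter [] q = coeff q 0"
| "polar_iter (r # rs) q = polar_iter rs (polar (Suc (length rs)) r q)"

text \<open>Laguerre's theorem is applied once per pole: \<open>Im w > 0\<close> puts
  \<open>1 / r\<close> into the zero-free half-plane, which the polar derivative inherits.\<close>

lemma polar_iter_nonzero:
  assumes "degree q \<le> length rs" "\<And>r. r \<in> set rs \<Longrightarrow> r > 0"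
    and "\<And>s. Im (w * s) > 0 \<Longrightarrow> poly q s \<noteq> 0" and w: "Im w > 0"
  shows "polar_iter rs q \<noteq> 0"
  using assms(1-3)
proof (induction rs arbitrary: q)
  case Nil
  then obtain c where "q = [:c:]" by (auto elim: degree_eq_zeroE)
  with Nil(3)[of 1] w show ?case by simp
next
  case (Cons r rs)
  have r: "r > 0" using Cons.prems by simp
  have "poly (polar (Suc (length rs)) r q) s \<noteq> 0" if "Im (w * s) > 0" for s
  proof -
    have "Im (w * (1 / of_real r)) = Im w / r" by (simp add: Im_divide_of_real)
    hence *: "Im (w * (1 / of_real r)) > 0" using r w by simp
    have "poly (polar (Suc (length rs)) r q) s = of_real r *
        (of_nat (Suc (length rs)) * poly q s - (s - 1 / of_real r) * poly (pderiv q) s)"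
      using r by (simp add: polar_def field_simps)
    thus ?thesis
      using polar_derivative_nonzero[OF _ _ Cons.prems(3) that *, where n = "Suc (length rs)"]
        Cons.prems(1) r by simp
  qed
  thus ?case
    using Cons.IH[of "polar (Suc (length rs)) r q"] Cons.prems degree_polar[of q "length rs" r]
    by simp
qed

text \<open>The right side is the apolar pairing of \<open>q\<close> with the product of the
  \<open>[:r, 1:]\<close>. In the induction the two summands of \<open>coeff_polar\<close> match
  \<open>t * G\<close> and \<open>r * G\<close> in the expansion of
  \<open>(t + r) * G\<close>.\<close>

lemma polar_iter_eq_sum:
  "polar_iter rs q = (\<Sum>i\<le>length rs. of_real (fact i * fact (length rs - i)
       * coeff (\<Prod>r\<leftarrow>rs. [:r, 1:]) i) * coeff q i)"
proof (induction rs arbitrary: q)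
  case Nil
  then show ?case by simp
next
  case (Cons r rs)
  let ?n = "length rs" and ?G = "\<Prod>r\<leftarrow>rs. [:r, 1:]"
  have "degree ?G \<le> ?n"
  proof (induction rs)
    case (Cons a rs)
    have "degree ([:a, 1:] * (\<Prod>r\<leftarrow>rs. [:r, 1:])) \<le> 1 + degree (\<Prod>r\<leftarrow>rs. [:r, 1:])"
      by (rule order.trans[OF degree_mult_le]) simp
    with Cons show ?case by (simp del: mult_pCons_left)
  qed simp
  hence G0: "coeff ?G (Suc ?n) = 0" by (simp add: coeff_eq_0)
  have c: "coeff ([:r, 1:] * ?G) i = r * coeff ?G i + coeff (pCons 0 ?G) i" for i
    by simp
  have "polar_iter (r # rs) q = (\<Sum>i\<le>?n. of_real (fact i * fact (?n - i) * coeff ?G i)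
      * (of_nat (Suc i) * coeff q (Suc i) + of_real r * (of_nat (Suc ?n) - of_nat i) * coeff q i))"
    by (simp add: Cons.IH coeff_polar del: of_nat_Suc)
  also have "\<dots> = (\<Sum>i\<le>?n. of_real (fact (Suc i) * fact (?n - i) * coeff ?G i) * coeff q (Suc i))
     + (\<Sum>i\<le>?n. of_real (fact i * fact (Suc ?n - i) * (r * coeff ?G i)) * coeff q i)"
    unfolding sum.distrib [symmetric]
    by (intro sum.cong refl)
       (simp add: Suc_diff_le of_nat_diff algebra_simps del: of_nat_Suc, simp add: algebra_simps)
  also have "(\<Sum>i\<le>?n. of_real (fact (Suc i) * fact (?n - i) * coeff ?G i) * coeff q (Suc i))
     = (\<Sum>i\<le>Suc ?n. of_real (fact i * fact (Suc ?n - i) * coeff (pCons 0 ?G) i) * coeff q i)"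
    by (subst sum.atMost_Suc_shift) simp
  also have "(\<Sum>i\<le>?n. of_real (fact i * fact (Suc ?n - i) * (r * coeff ?G i)) * coeff q i)
     = (\<Sum>i\<le>Suc ?n. of_real (fact i * fact (Suc ?n - i) * (r * coeff ?G i)) * coeff q i)"
    using G0 by simp
  also have "(\<Sum>i\<le>Suc ?n. of_real (fact i * fact (Suc ?n - i) * coeff (pCons 0 ?G) i) * coeff q i) + \<dots>
     = (\<Sum>i\<le>Suc ?n. of_real (fact i * fact (Suc ?n - i) * coeff ([:r, 1:] * ?G) i) * coeff q i)"
    unfolding sum.distrib [symmetric] c by (intro sum.cong refl) (simp add: algebra_simps)
  finally show ?case by simp
qed

text \<open>The binomial weights turn the factor \<open>fact i * fact (n - i)\<close> of the apolar
  pairing into the constant \<open>fact n\<close>.\<close>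

definition binomial_poly :: "nat \<Rightarrow> (nat \<Rightarrow> real) \<Rightarrow> real poly" where
  "binomial_poly n \<gamma> = (\<Sum>i\<le>n. monom (of_nat (n choose i) * \<gamma> i) i)"

lemma coeff_binomial_poly:
  "coeff (binomial_poly n \<gamma>) i = (if i \<le> n then of_nat (n choose i) * \<gamma> i else 0)"
  by (simp add: binomial_poly_def coeff_sum)

lemma coeff_diag_op: "coeff (diag_op n \<gamma> p) i = (if i \<le> n then \<gamma> i * coeff p i else 0)"
  by (simp add: diag_op_def coeff_sum)

lemma degree_diag_op: "degree (diag_op n \<gamma> p) \<le> n"
  by (rule degree_le) (simp add: coeff_diag_op)

lemma poly_eq_sum_le:
  fixes p :: "'a::comm_semiring_1 poly"
  assumes "degree p \<le> n"
  shows "poly p x = (\<Sum>i\<le>n. coeff p i * x ^ i)"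
  unfolding poly_altdef using assms
  by (intro sum.mono_neutral_left) (auto simp: coeff_eq_0 not_le)

text \<open>With \<open>p\<close> real-rooted and \<open>z\<close> in the upper half-plane, the polynomial \<open>s \<mapsto> p (z s)\<close> has no zeros
  in a half-plane containing the positive reals, and the transform of \<open>p\<close> at \<open>z\<close> is its iterated
  polar derivative with the positive reals \<open>1 / r\<close> as poles.\<close>

theorem n_sequence_if_binomial_poly_splits:
  assumes F: "binomial_poly n \<gamma> = smult c (\<Prod>r\<leftarrow>rs. [:r, 1:])" and c: "c \<noteq> 0"
    and len: "length rs = n" and pos: "\<And>r. r \<in> set rs \<Longrightarrow> r > 0"
  shows "n_sequence n \<gamma>"
  unfolding n_sequence_def
proof (intro allI impI)
  fix p :: "real poly"
  assume deg: "degree p \<le> n" and real: "only_real_zeros p"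
  let ?C = "map_poly complex_of_real"
  \<comment> \<open>The upper half-plane suffices: the coefficients are real, so non-real zeros come
    in conjugate pairs.\<close>
  have nz: "poly (?C (diag_op n \<gamma> p)) z \<noteq> 0" if z: "Im z > 0" for z
  proof -
    define q where "q = (\<Sum>i\<le>n. monom (of_real (coeff p i) * z ^ i) i)"
    have cq: "coeff q i = of_real (coeff p i) * z ^ i" for i
      using deg by (auto simp: q_def coeff_sum coeff_eq_0)
    have pq: "poly q s = poly (?C p) (z * s)" for s
    proof -
      have "poly (?C p) (z * s) = (\<Sum>i\<le>n. coeff (?C p) i * (z * s) ^ i)"
        by (rule poly_eq_sum_le) (use deg in \<open>simp add: degree_map_poly\<close>)
      thus ?thesis
        by (simp add: q_def poly_sum poly_monom coeff_map_poly power_mult_distrib mult.assoc)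
    qed
    have q_nz: "poly q s \<noteq> 0" if "Im (z * s) > 0" for s
      using that real unfolding pq only_real_zeros_def by (auto simp: complex_is_Real_iff)
    have "degree q \<le> length rs"
      unfolding len by (rule degree_le) (use deg in \<open>simp add: cq coeff_eq_0\<close>)
    hence "polar_iter rs q \<noteq> 0"
      by (rule polar_iter_nonzero[OF _ pos q_nz z])
    moreover have "of_real c * polar_iter rs q = fact n * poly (?C (diag_op n \<gamma> p)) z"
    proof -
      have g: "c * coeff (\<Prod>r\<leftarrow>rs. [:r, 1:]) i = of_nat (n choose i) * \<gamma> i" if "i \<le> n" for i
        using arg_cong[OF F, of "\<lambda>p. coeff p i"] that by (simp add: coeff_binomial_poly)
      have "of_real c * polar_iter rs q = (\<Sum>i\<le>n. of_real (fact i * fact (n - i)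
          * (c * coeff (\<Prod>r\<leftarrow>rs. [:r, 1:]) i)) * coeff q i)"
        unfolding polar_iter_eq_sum len sum_distrib_left by (intro sum.cong refl) simp
      also have "\<dots> = (\<Sum>i\<le>n. of_real (fact n * \<gamma> i) * coeff q i)"
      proof (intro sum.cong refl)
        fix i assume "i \<in> {..n}"
        hence i: "i \<le> n" by simp
        have "fact i * fact (n - i) * real (n choose i) = fact n"
          using binomial_fact_lemma[OF i] by (metis of_nat_fact of_nat_mult)
        thus "of_real (fact i * fact (n - i) * (c * coeff (\<Prod>r\<leftarrow>rs. [:r, 1:]) i)) * coeff q i =
            of_real (fact n * \<gamma> i) * coeff q i"
          unfolding g[OF i] by (metis mult.assoc)
      qed
      also have "\<dots> = fact n * (\<Sum>i\<le>n. coeff (?C (diag_op n \<gamma> p)) i * z ^ i)"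
        unfolding sum_distrib_left
        by (intro sum.cong refl) (simp add: cq coeff_map_poly coeff_diag_op algebra_simps)
      also have "(\<Sum>i\<le>n. coeff (?C (diag_op n \<gamma> p)) i * z ^ i) = poly (?C (diag_op n \<gamma> p)) z"
        by (rule poly_eq_sum_le [symmetric])
           (simp add: degree_map_poly degree_diag_op)
      finally show ?thesis .
    qed
    ultimately show ?thesis using c by auto
  qed
  show "only_real_zeros (diag_op n \<gamma> p)"
    unfolding only_real_zeros_def
  proof (intro allI impI)
    fix z assume z0: "poly (?C (diag_op n \<gamma> p)) z = 0"
    have "poly (?C (diag_op n \<gamma> p)) (cnj z) = 0"
      using z0 poly_cnj_real[of "?C (diag_op n \<gamma> p)" z] by (simp add: coeff_map_poly)
    with z0 nz[of z] nz[of "cnj z"] show "z \<in> \<real>"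
      by (cases "Im z" "0::real" rule: linorder_cases) (auto simp: complex_is_Real_iff)
  qed
qed

subsection \<open>Linear and quadratic \<open>d\<close>-sequences\<close>

lemma n_sequence_mult:
  assumes "n_sequence d g" "n_sequence d h"
  shows "n_sequence d (\<lambda>i. g i * h i)"
proof -
  have "diag_op d (\<lambda>i. g i * h i) p = diag_op d g (diag_op d h p)" for p
    by (rule poly_eqI) (simp add: coeff_diag_op)
  with assms degree_diag_op show ?thesis
    by (simp add: n_sequence_def)
qed

lemma coeff_one_plus_X_power: "coeff ([:1, 1 :: real:] ^ n) i = of_nat (n choose i)"
  by (cases "i \<le> n") (auto simp: coeff_linear_poly_power coeff_eq_0 degree_linear_power binomial_eq_0)

lemma n_sequence_const:
  assumes "c \<noteq> 0"
  shows "n_sequence d (\<lambda>_. c)"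
proof (rule n_sequence_if_binomial_poly_splits)
  show "binomial_poly d (\<lambda>_. c) = smult c (\<Prod>r\<leftarrow>replicate d 1. [:r, 1:])"
    by (rule poly_eqI)
       (simp add: coeff_binomial_poly prod_list_replicate coeff_one_plus_X_power binomial_eq_0)
qed (use assms in auto)

text \<open>In generating functions: weighting the coefficients of \<open>(1 + t) ^ d\<close> by
  \<open>d - i\<close> gives \<open>d * (1 + t) ^ (d - 1)\<close>.\<close>

lemma binomial_absorb_real:
  assumes "i \<le> d"
  shows "real d * real (d - 1 choose i) = (real d - real i) * real (d choose i)"
proof -
  have "real (d - i) * real (d choose i) = real d * real (d - 1 choose i)"
    using binomial_absorb_comp[of d i] by (metis of_nat_mult)
  with assms show ?thesis by (simp add: of_nat_diff)
qed

lemma binomial_absorb_real2: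
  assumes "i \<le> d"
  shows "real d * (real d - 1) * real (d - 2 choose i)
    = (real d - real i) * (real d - real i - 1) * real (d choose i)"
\<comment> \<open>The second absorption is applied to \<open>d - 1\<close> and needs
  \<open>i \<le> d - 1\<close>. For \<open>i = d\<close> both sides vanish; truncation in
  \<open>d - 2\<close> is harmless because \<open>d * (d - 1)\<close> is then 0.\<close>
proof (cases "i = d")
  case True
  then show ?thesis
    by (cases d rule: nat.exhaust; cases "d = 1") (auto simp: binomial_eq_0)
next
  case False
  hence "(real d - 1) * real (d - 2 choose i) = (real d - real i - 1) * real (d - 1 choose i)"
    using binomial_absorb_real[of i "d - 1"] assms by (auto simp: of_nat_diff numeral_2_eq_2)
  with binomial_absorb_real[OF assms] show ?thesis
    by (metis mult.assoc mult.left_commute)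
qed

text \<open>Expanding around \<open>1 + t\<close> leaves powers of \<open>1 + t\<close>
  intact.\<close>

lemma linear_shift_mult: "[:1 + x, 1:] * q = [:1, 1:] * q + smult x q" for q :: "real poly"
  by (simp add: smult_add_left)

text \<open>The binomial polynomial is \<open>- r * (1 + t) ^ (d - 1) * (t + 1 - d / r)\<close>, and
  \<open>r\<close> outside the interval from 0 to \<open>d\<close> means
  \<open>d / r < 1\<close>.\<close>

lemma n_sequence_linear:
  assumes r: "r < 0 \<or> r > real d" and d: "d > 0"
  shows "n_sequence d (\<lambda>i. (real d - real i) - r)"
proof (rule n_sequence_if_binomial_poly_splits)
  let ?w = "[:1, 1 :: real:]"
  have r0: "r \<noteq> 0" using r d by auto
  have eq: "[:1 - real d / r, 1:] * ?w ^ (d - 1) = ?w ^ d + smult (- (real d / r)) (?w ^ (d - 1))"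
    using linear_shift_mult[of "- (real d / r)" "?w ^ (d - 1)"] d
    by (cases d) (simp_all del: mult_pCons_left)
  have prd: "(\<Prod>s\<leftarrow>(1 - real d / r) # replicate (d - 1) 1. [:s, 1:])
      = ?w ^ d + smult (- (real d / r)) (?w ^ (d - 1))"
    unfolding list.map prod_list.Cons map_replicate prod_list_replicate eq ..
  show "binomial_poly d (\<lambda>i. (real d - real i) - r)
      = smult (- r) (\<Prod>s\<leftarrow>(1 - real d / r) # replicate (d - 1) 1. [:s, 1:])"
    unfolding prd
  proof (rule poly_eqI)
    fix i
    show "coeff (binomial_poly d (\<lambda>i. (real d - real i) - r)) i
      = coeff (smult (- r) (?w ^ d + smult (- (real d / r)) (?w ^ (d - 1)))) i"
      using binomial_absorb_real[of i d] r0
      by (cases "i \<le> d")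
         (auto simp: coeff_binomial_poly coeff_one_plus_X_power binomial_eq_0 algebra_simps)
  qed
  show "0 < s" if "s \<in> set ((1 - real d / r) # replicate (d - 1) 1)" for s
  proof -
    have "real d / r < 1" using r d by (auto simp: divide_less_eq)
    thus ?thesis using that by auto
  qed
qed (use assms in auto)

text \<open>With \<open>w = 1 + t\<close> the binomial polynomial is
  \<open>w ^ (d - 2) * (g * w ^ 2 + B * d * w + d * (d - 1))\<close>. The discriminant
  \<open>D\<close> of the last factor is nonnegative since \<open>d * (d - 1) \<le> d ^ 2\<close>,
  and its zeros \<open>- u\<close> and \<open>- v\<close> in \<open>w\<close> are at most 0, so
  those in \<open>t\<close> are at most -1.\<close>

lemma n_sequence_quadratic:
  assumes g: "g > 0" and B: "B > 0" "B\<^sup>2 \<ge> 4 * g" and d: "d \<ge> 2"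
  shows "n_sequence d (\<lambda>i. (real d - real i) * (real d - real i - 1) + B * (real d - real i) + g)"
proof (rule n_sequence_if_binomial_poly_splits)
  let ?w = "[:1, 1 :: real:]"
  define D where "D = (B * real d)\<^sup>2 - 4 * g * (real d * (real d - 1))"
  have "4 * g * (real d)\<^sup>2 \<le> B\<^sup>2 * (real d)\<^sup>2"
    using B by (intro mult_right_mono) auto
  moreover have "4 * g * (real d * (real d - 1)) \<le> 4 * g * (real d)\<^sup>2"
    using g by (simp add: power2_eq_square algebra_simps)
  ultimately have D0: "D \<ge> 0" unfolding D_def by (simp add: power_mult_distrib)
  have "D \<le> (B * real d)\<^sup>2"
    using g d by (simp add: D_def)
  hence sqrt_le: "sqrt D \<le> B * real d"
    using B by (intro real_le_lsqrt) auto
  define u v where "u = (B * real d + sqrt D) / (2 * g)" and "v = (B * real d - sqrt D) / (2 * g)"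
  have uv: "u \<ge> 0" "v \<ge> 0"
    using sqrt_le D0 g B by (auto simp: u_def v_def)
  have sum: "g * (u + v) = B * real d"
    using g by (simp add: u_def v_def field_simps)
  have "u * v = ((B * real d)\<^sup>2 - (sqrt D)\<^sup>2) / (2 * g)\<^sup>2"
    by (simp add: u_def v_def power2_eq_square algebra_simps)
  also have "\<dots> = real d * (real d - 1) / g"
    using D0 g by (simp add: D_def power2_eq_square field_simps)
  finally have prd: "g * (u * v) = real d * (real d - 1)" using g by simp
  have d_eq: "?w ^ d = ?w * (?w * ?w ^ (d - 2))" "?w ^ (d - 1) = ?w * ?w ^ (d - 2)"
    using d by (auto simp del: mult_pCons_left simp flip: power_Suc simp: numeral_2_eq_2 Suc_diff_Suc)
  have eq: "[:1 + u, 1:] * ([:1 + v, 1:] * ?w ^ (d - 2))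
      = ?w ^ d + smult (u + v) (?w ^ (d - 1)) + smult (u * v) (?w ^ (d - 2))"
    unfolding linear_shift_mult d_eq
    by (simp add: algebra_simps smult_add_left smult_add_right
        del: mult_pCons_left mult_pCons_right)
  have list: "(\<Prod>s\<leftarrow>(1 + u) # (1 + v) # replicate (d - 2) 1. [:s, 1:])
      = ?w ^ d + smult (u + v) (?w ^ (d - 1)) + smult (u * v) (?w ^ (d - 2))"
    unfolding list.map prod_list.Cons map_replicate prod_list_replicate eq ..
  show "binomial_poly d (\<lambda>i. (real d - real i) * (real d - real i - 1) + B * (real d - real i) + g)
      = smult g (\<Prod>s\<leftarrow>(1 + u) # (1 + v) # replicate (d - 2) 1. [:s, 1:])"
    unfolding list
  proof (rule poly_eqI)
    fix i
    have "g * (x + (u + v) * y + u * v * z) = g * x + (g * (u + v)) * y + (g * (u * v)) * z" for x y z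
      by (simp add: algebra_simps)
    hence "coeff (smult g (?w ^ d + smult (u + v) (?w ^ (d - 1)) + smult (u * v) (?w ^ (d - 2)))) i
      = g * real (d choose i) + B * (real d * real (d - 1 choose i))
         + real d * (real d - 1) * real (d - 2 choose i)"
      by (simp add: coeff_one_plus_X_power sum prd)
    also have "\<dots> = coeff (binomial_poly d (\<lambda>i. (real d - real i) * (real d - real i - 1)
        + B * (real d - real i) + g)) i"
    proof (cases "i \<le> d")
      case True
      show ?thesis
        unfolding binomial_absorb_real[OF True] binomial_absorb_real2[OF True]
        using True by (simp add: coeff_binomial_poly algebra_simps)
    qed (simp add: coeff_binomial_poly binomial_eq_0)
    finally show "coeff (binomial_poly d (\<lambda>i. (real d - real i) * (real d - real i - 1)
        + B * (real d - real i) + g)) i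
      = coeff (smult g (?w ^ d + smult (u + v) (?w ^ (d - 1)) + smult (u * v) (?w ^ (d - 2)))) i" ..
  qed
  show "0 < s" if "s \<in> set ((1 + u) # (1 + v) # replicate (d - 2) 1)" for s
    using that uv by auto
qed (use assms in auto)

section \<open>Zeros from sign changes, and the linear factors they split off\<close>

text \<open>The intermediate value theorem gives one zero per gap. The points decrease, so each new
  zero lies below all earlier ones.\<close>

lemma sign_changes_imp_roots:
  fixes p :: "real poly"
  assumes "\<And>k. k < n \<Longrightarrow> x (Suc k) < x k \<and> poly p (x k) * poly p (x (Suc k)) < 0"
  shows "\<exists>R. finite R \<and> card R = n \<and> (\<forall>r\<in>R. poly p r = 0 \<and> x n < r \<and> r < x 0)"
  using assms
proof (induction n)
  case 0
  then show ?case by (intro exI[of _ "{}"]) auto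
next
  case (Suc n)
  note step = Suc.prems
  obtain R where R: "finite R" "card R = n" "\<And>r. r \<in> R \<Longrightarrow> poly p r = 0 \<and> x n < r \<and> r < x 0"
    using Suc by force
  have "x (Suc n) < x n" "poly p (x (Suc n)) * poly p (x n) < 0"
    using Suc.prems[of n] by (auto simp: mult.commute)
  then obtain s where s: "x (Suc n) < s" "s < x n" "poly p s = 0"
    using poly_IVT by blast
  have "k \<le> n \<Longrightarrow> x k \<le> x 0" for k
  proof (induction k)
    case (Suc k)
    thus ?case using Suc.prems step[of k] by simp
  qed simp
  hence "x n \<le> x 0" by simp
  with s R have "s \<notin> R" by force
  with s R \<open>x n \<le> x 0\<close> show ?case
    by (intro exI[of _ "insert s R"]) force
qed

lemma poly_factor_roots:
  fixes p :: "'a::idom poly"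
  assumes "finite R" "\<And>r. r \<in> R \<Longrightarrow> poly p r = 0"
  shows "\<exists>q. p = (\<Prod>r\<in>R. [:-r, 1:]) * q"
  using assms
proof (induction R)
  case empty
  then show ?case by auto
next
  case (insert s R)
  then obtain q where q: "p = (\<Prod>r\<in>R. [:-r, 1:]) * q" by auto
  have "poly p s = 0" using insert.prems by simp
  hence "poly q s = 0"
    using insert.hyps by (auto simp: q poly_prod)
  then obtain q' where "q = [:-s, 1:] * q'"
    by (auto simp: poly_eq_0_iff_dvd elim: dvdE)
  with q insert.hyps show ?case
    by (intro exI[of _ q']) (simp only: prod.insert mult_ac not_False_eq_True)
qed

subsection \<open>The sequence as a polynomial\<close>

definition rise :: "'a::comm_ring_1 \<Rightarrow> nat \<Rightarrow> 'a \<Rightarrow> 'a" where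
  "rise s n X = (\<Prod>l<n. X + s * of_nat l)"

text \<open>\<open>fnum 1 m i j\<close> is \<open>m! (m - 1)!\<close> times the term \<open>f\<^sub>m(d, i)\<close> with \<open>d = i + j\<close>; the
  homogenising step \<open>s\<close> clears the denominators of half-integral arguments (\<open>s = 2\<close>).\<close>

fun fnum :: "'a::comm_ring_1 \<Rightarrow> nat \<Rightarrow> 'a \<Rightarrow> 'a \<Rightarrow> 'a" where
  "fnum s 0 X Y = 0"
| "fnum s (Suc n) X Y =
     s * of_nat n * (X + s * of_nat (Suc n)) * fnum s n X Y + rise s n X * rise s n (Y + s)"

lemma rise_one: "rise 1 n X = pochhammer X n"
  by (simp add: rise_def pochhammer_prod lessThan_atLeast0)

lemma rise_Suc: "rise s (Suc n) X = rise s n X * (X + s * of_nat n)"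
  by (simp add: rise_def)

lemma rise_of_int: "rise (of_int s) n (of_int X) = of_int (rise s n X)"
  by (simp add: rise_def)

lemma fnum_of_int: "fnum (of_int s) n (of_int X) (of_int Y) = of_int (fnum s n X Y)"
proof (induction n)
  case (Suc n)
  have "rise (of_int s) n (of_int Y + of_int s :: 'a) = of_int (rise s n (Y + s))"
    by (simp flip: rise_of_int)
  with Suc show ?case by (simp add: rise_of_int)
qed simp

lemma rise_scale: "rise s n (s * X) = s ^ n * rise 1 n X"
  by (simp add: rise_def prod.distrib flip: distrib_left)

text \<open>The extra factor \<open>s\<close> in the recurrence makes
  \<open>fnum s (Suc n) X Y\<close> homogeneous of degree \<open>2 * n\<close> in \<open>s\<close>,
  \<open>X\<close> and \<open>Y\<close> together.\<close>

lemma fnum_scale: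
  fixes s :: "'a::comm_ring_1"
  shows "fnum s (Suc n) (s * X) (s * Y) = s ^ (2 * n) * fnum 1 (Suc n) X Y"
proof (induction n)
  case (Suc n)
  have 1: "rise s k (s * Y + s) = s ^ k * rise 1 k (Y + 1)" for k
    using rise_scale[of s k "Y + 1"] by (simp add: algebra_simps)
  have 2: "s * X + s * of_nat k = s * (X + of_nat k)" for k
    by (simp add: algebra_simps)
  have 3: "s * N * (s * Z) * (s ^ (2 * n) * V) + s ^ Suc n * R * (s ^ Suc n * Q)
      = s ^ (2 * Suc n) * (1 * N * Z * V + R * Q)" for N Z V R Q :: 'a
    by (simp add: power_mult power2_eq_square power_mult_distrib algebra_simps)
  show ?case
    unfolding fnum.simps(2)[of _ "Suc n"] Suc.IH 1 2 3 rise_scale mult_1_left ..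
qed (simp add: rise_def)

text \<open>In the step from \<open>n\<close> to \<open>Suc n\<close>, the factor
  \<open>X + n + 1\<close> is the next factor of every
  \<open>pochhammer (X + h + 2) (n - h - 1)\<close>, the factor \<open>n\<close> raises
  \<open>fact (n - 1)\<close> to \<open>fact n\<close>, and the added product is the new summand
  \<open>h = n\<close>.\<close>

lemma fnum_eq_sum:
  fixes X Y :: real
  shows "fnum 1 m X Y = fact (m - 1) * (\<Sum>h<m. pochhammer X h
     * pochhammer (X + real h + 2) (m - h - 1) * pochhammer (Y + 1) h / fact h)"
proof (induction m)
  case (Suc n)
  let ?T = "\<lambda>m h. pochhammer X h * pochhammer (X + real h + 2) (m - h - 1)
     * pochhammer (Y + 1) h / fact h"
  have "real n * fnum 1 n X Y = fact n * (\<Sum>h<n. ?T n h)"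
    unfolding Suc.IH using fact_reduce[where ?'a = real and n = n] by (cases "n = 0") simp_all
  hence "fnum 1 (Suc n) X Y = (X + real (Suc n)) * (fact n * (\<Sum>h<n. ?T n h))
      + pochhammer X n * pochhammer (Y + 1) n"
    by (simp only: fnum.simps rise_one mult_1_left) (simp add: algebra_simps)
  also have "(X + real (Suc n)) * (fact n * (\<Sum>h<n. ?T n h)) = fact n * (\<Sum>h<n. ?T (Suc n) h)"
  proof -
    have "(X + real (Suc n)) * ?T n h = ?T (Suc n) h" if "h < n" for h
    proof -
      have "Suc n - h - 1 = Suc (n - h - 1)" using that by simp
      thus ?thesis using that by (simp add: pochhammer_Suc of_nat_diff algebra_simps)
    qed
    hence "(X + real (Suc n)) * (\<Sum>h<n. ?T n h) = (\<Sum>h<n. ?T (Suc n) h)"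
      unfolding sum_distrib_left by (intro sum.cong) auto
    thus ?thesis
      by (simp only: mult.left_commute[of "X + real (Suc n)" "fact n"])
  qed
  also have "pochhammer X n * pochhammer (Y + 1) n = fact n * ?T (Suc n) n"
    by simp
  finally show ?case by (simp add: distrib_left)
qed simp

text \<open>The weight \<open>1 / ((m - h) * (m choose h))\<close> equals
  \<open>fact h * fact (m - h - 1) / fact m\<close>; it cancels the denominator of the first
  binomial coefficient and one \<open>fact h\<close> of the other two.\<close>

lemma f_seq_eq_fnum:
  assumes "m > 0"
  shows "f_seq m d i = fnum 1 m (real i) (real d - real i) / (fact m * fact (m - 1))"
proof -
  have t: "1 / ((real m - real h) * (real m gchoose h))
        * ((real i + real m) gchoose (m - h - 1))
        * ((real i - 1 + real h) gchoose h) * ((real d - real i + real h) gchoose h)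
     = pochhammer (real i) h * pochhammer (real i + real h + 2) (m - h - 1)
        * pochhammer (real d - real i + 1) h / fact h / fact m" if h: "h < m" for h
  proof -
    have "real (fact m) = fact h * fact (m - h) * real (m choose h)"
      using binomial_fact_lemma[of h m] h by (metis less_imp_le of_nat_fact of_nat_mult)
    moreover have "(fact (m - h) :: real) = (real m - real h) * fact (m - h - 1)"
      using h fact_reduce[where ?'a = real and n = "m - h"] by (simp add: of_nat_diff)
    ultimately have fm: "fact m = fact h * ((real m - real h) * fact (m - h - 1)) * real (m choose h)"
      by simp
    have "real (m choose h) \<noteq> 0" "real m - real h \<noteq> 0"
      using h by auto
    thus ?thesis
      using h unfolding gbinomial_pochhammer'[of "real i + real m"]
        gbinomial_pochhammer'[of "real i - 1 + real h"]
        gbinomial_pochhammer'[of "real d - real i + real h"] fm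
      by (simp add: of_nat_diff field_simps flip: binomial_gbinomial)
  qed
  have "{0..m - 1} = {..<m}" using assms by auto
  hence "f_seq m d i = (\<Sum>h<m. pochhammer (real i) h * pochhammer (real i + real h + 2) (m - h - 1)
        * pochhammer (real d - real i + 1) h / fact h / fact m)"
    unfolding f_seq_def using t by (rule sum.cong) blast
  also have "\<dots> = (\<Sum>h<m. pochhammer (real i) h * pochhammer (real i + real h + 2) (m - h - 1)
        * pochhammer (real d - real i + 1) h / fact h) / fact m"
    by (simp add: sum_divide_distrib)
  finally show ?thesis
    by (simp add: fnum_eq_sum)
qed

fun fpoly :: "real \<Rightarrow> nat \<Rightarrow> real poly" where
  "fpoly d 0 = 0"
| "fpoly d (Suc n) = [:real n * (d + real (Suc n)), - real n:] * fpoly d n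
     + (\<Prod>l<n. [:d + real l, -1:] * [:real (Suc l), 1:])"

lemma poly_fpoly: "poly (fpoly d m) x = fnum 1 m (d - x) x"
  by (induction m) (simp_all add: rise_def poly_prod algebra_simps flip: prod.distrib)

text \<open>The added product has degree \<open>2 * n\<close> and dominates the recursive term,
  whose degree is at most \<open>2 * n - 1\<close>.\<close>

lemma fpoly_degree: "degree (fpoly d (Suc n)) = 2 * n \<and> lead_coeff (fpoly d (Suc n)) = (-1) ^ n"
proof (induction n)
  case (Suc n)
  let ?f = "\<lambda>l. [:d + real l, -1:] * [:real (Suc l), 1:]"
  let ?G = "\<Prod>l<Suc n. ?f l"
  have f: "degree (?f l) = 2" "lead_coeff (?f l) = -1" for l
    by simp_all
  have dG: "degree ?G = 2 * Suc n"
    by (subst degree_prod_eq_sum_degree) (auto simp: f simp del: mult_pCons_left)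
  have lG: "lead_coeff ?G = (-1) ^ Suc n"
  proof -
    have "lead_coeff ?G = (\<Prod>l<Suc n. lead_coeff (?f l))"
      by (rule lead_coeff_prod)
    also have "\<dots> = (\<Prod>l<Suc n. -1)"
      by (intro prod.cong refl f)
    finally show ?thesis by simp
  qed
  have "degree ([:real (Suc n) * (d + real (Suc (Suc n))), - real (Suc n):] * fpoly d (Suc n)) \<le> 1 + 2 * n"
    using Suc by (intro order.trans[OF degree_mult_le]) simp
  hence lt: "degree ([:real (Suc n) * (d + real (Suc (Suc n))), - real (Suc n):] * fpoly d (Suc n))
      < degree ?G"
    unfolding dG by simp
  show ?case
    unfolding fpoly.simps(2)[of d "Suc n"]
    using degree_add_eq_right[OF lt] lead_coeff_add_le[OF lt] dG lG by simp
qed simp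

section \<open>Zeros beyond \<open>d\<close>, that is, at negative \<open>i\<close>\<close>

text \<open>At \<open>X = - k\<close> the added product vanishes as soon as \<open>n > k\<close>, so
  from then on the recurrence only multiplies by the positive number \<open>n * (n + 1 - k)\<close>.
  The sign is therefore decided at \<open>m = k + 1\<close>.\<close>

lemma fnum_left_sign:
  fixes d :: real
  assumes "d > 0" "k < m"
  shows "(-1) ^ k * fnum 1 m (- real k) (d + real k) > 0"
  using assms(2)
proof (induction m)
  case (Suc n)
  show ?case
  proof (cases "k = n")
    case False
    hence k: "k < n" using Suc.prems by simp
    hence "fnum 1 (Suc n) (- real k) (d + real k)
        = real n * (real (Suc n) - real k) * fnum 1 n (- real k) (d + real k)"
      by (simp add: rise_one pochhammer_of_nat_eq_0_lemma algebra_simps)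
    hence "(-1) ^ k * fnum 1 (Suc n) (- real k) (d + real k)
        = (real n * (real (Suc n) - real k)) * ((-1) ^ k * fnum 1 n (- real k) (d + real k))"
      by (metis mult.left_commute)
    moreover have "0 < real n * (real (Suc n) - real k)"
      using k by (intro mult_pos_pos) auto
    ultimately show ?thesis
      using Suc.IH[OF k] by (metis mult_pos_pos)
  next
    case True
    show ?thesis
    proof (cases n)
      case 0
      with True show ?thesis by (simp add: rise_def)
    next
      case (Suc n')
      let ?j = "d + real k"
      \<comment> \<open>Unfolding twice: in the inner step the factor \<open>- k + Suc n'\<close> is
        0 and removes \<open>fnum 1 n'\<close>; the two products left combine with the factor
        \<open>k - (?j + k) = - ?j\<close>.\<close>
      have "fnum 1 (Suc n) (- real k) ?j = - (pochhammer (- real k) n' * pochhammer (?j + 1) n' * ?j)"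
        using True Suc by (simp add: rise_one pochhammer_Suc algebra_simps)
      moreover have "pochhammer (- real k) n' = (- 1) ^ n' * pochhammer 2 n'"
        using True Suc pochhammer_minus[of "real k" n'] by simp
      moreover have "(-1 :: real) ^ k = - ((- 1) ^ n')" using True Suc by simp
      moreover have "- e * - (e * P * Q * j) = P * Q * j" if "e * e = 1" for e P Q j :: real
        using that by algebra
      moreover have "(-1 :: real) ^ n' * (- 1) ^ n' = 1" by (simp flip: power_mult_distrib)
      ultimately have "(-1) ^ k * fnum 1 (Suc n) (- real k) ?j
          = pochhammer 2 n' * pochhammer (?j + 1) n' * ?j"
        by metis
      moreover have "0 < pochhammer 2 n' * pochhammer (?j + 1) n' * ?j"
        using assms(1) by (intro mult_pos_pos pochhammer_pos) auto
      ultimately show ?thesis by simp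
    qed
  qed
qed simp

lemma fpoly_left_roots:
  assumes "d > 0" "m > 0"
  shows "\<exists>R. finite R \<and> card R = m - 1 \<and> (\<forall>r\<in>R. poly (fpoly d m) r = 0 \<and> d < r)"
proof -
  define x where "x k = d + (real m - 1 - real k)" for k
  have "x (Suc k) < x k \<and> poly (fpoly d m) (x k) * poly (fpoly d m) (x (Suc k)) < 0" if k: "k < m - 1" for k
  proof -
    define l where "l = m - 2 - k"
    have l: "Suc l < m" "x (Suc k) = d + real l" "x k = d + real (Suc l)"
      using k by (auto simp: l_def x_def of_nat_diff)
    have "0 < (-1) ^ Suc l * poly (fpoly d m) (x k)" "0 < (-1) ^ l * poly (fpoly d m) (x (Suc k))"
      using fnum_left_sign[of d "Suc l" m] fnum_left_sign[of d l m] l assms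
      unfolding poly_fpoly by (auto simp del: power_Suc)
    hence "0 < ((-1) ^ Suc l * poly (fpoly d m) (x k)) * ((-1) ^ l * poly (fpoly d m) (x (Suc k)))"
      by (rule mult_pos_pos)
    also have "\<dots> = - (poly (fpoly d m) (x k) * poly (fpoly d m) (x (Suc k)))"
      by (simp add: algebra_simps flip: power_add power_mult_distrib)
    finally show ?thesis by (simp add: x_def)
  qed
  from sign_changes_imp_roots[of "m - 1" x, OF this] show ?thesis
    using assms by (auto simp: x_def of_nat_diff)
qed

lemma n_sequence_prod:
  assumes "finite R" "\<And>r. r \<in> R \<Longrightarrow> n_sequence d (g r)"
  shows "n_sequence d (\<lambda>i. \<Prod>r\<in>R. g r i)"
  using assms
proof (induction R)
  case empty
  show ?case using n_sequence_const[of 1 d] by simp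
next
  case (insert r R)
  have "n_sequence d (\<lambda>i. g r i * (\<Prod>r\<in>R. g r i))"
    using insert by (intro n_sequence_mult) simp_all
  with insert.hyps show ?case by simp
qed

text \<open>Each zero outside the interval from 0 to \<open>d\<close> contributes a linear
  \<open>d\<close>-sequence, so only the cofactor \<open>q\<close> remains to be treated.\<close>

lemma n_sequence_fpoly:
  assumes P: "fpoly (real d) m = (\<Prod>r\<in>R. [:-r, 1:]) * q" and R: "finite R"
    and out: "\<And>r. r \<in> R \<Longrightarrow> r < 0 \<or> r > real d" and d: "d > 0" and m: "m > 0"
    and q: "n_sequence d (\<lambda>i. poly q (real d - real i))"
  shows "n_sequence d (f_seq m d)"
proof -
  have "f_seq m d i = 1 / (fact m * fact (m - 1)) *
      ((\<Prod>r\<in>R. (real d - real i) - r) * poly q (real d - real i))" for i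
    using poly_fpoly[of "real d" m "real d - real i"] m
    by (simp add: f_seq_eq_fnum P poly_prod)
  hence "f_seq m d = (\<lambda>i. 1 / (fact m * fact (m - 1)) *
      ((\<Prod>r\<in>R. (real d - real i) - r) * poly q (real d - real i)))"
    by blast
  moreover have "n_sequence d (\<lambda>i. 1 / (fact m * fact (m - 1)) *
      ((\<Prod>r\<in>R. (real d - real i) - r) * poly q (real d - real i)))"
    using out d R q
    by (intro n_sequence_mult n_sequence_prod n_sequence_linear n_sequence_const) auto
  ultimately show ?thesis by simp
qed

text \<open>Here \<open>q\<close> and \<open>1 \<plusminus> 2 u + q\<close> are the values at \<open>-5/2\<close> and \<open>-5/2 \<plusminus> 1\<close> of the quadratic factor
  \<open>(x + 5/2)\<^sup>2 + 2 u (x + 5/2) + q\<close>, and \<open>A1, A2, A3\<close> those of the cofactor at \<open>-3/2, -5/2, -7/2\<close>.\<close>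

lemma quadratic_region:
  fixes u q a b p1 p2 p3 A1 A2 A3 :: real
  assumes A: "A1 * A3 > 0" "A1 * A2 > 0" "A1 * A3 \<le> A2\<^sup>2"
    and p: "p1 = A1 * (1 + 2 * u + q)" "p2 = A2 * q" "p3 = A3 * (1 - 2 * u + q)"
    and pos: "p1 > 0" "p3 > 0" "a > 0" "b > 0" "a * b \<ge> 49 / 25" "p1 \<ge> a * p2" "p3 \<ge> b * p2"
  shows "25 / 4 + 5 * u + q > 0 \<and> 6 + 2 * u > 0 \<and> (6 + 2 * u)\<^sup>2 \<ge> 4 * (25 / 4 + 5 * u + q)"
proof -
  \<comment> \<open>The bounds on the values give \<open>p1 * p3 \<ge> 49 / 25 * p2 ^ 2\<close>; the
    cofactor is then cancelled by \<open>A1 * A3 \<le> A2 ^ 2\<close>.\<close>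
  have ratio: "(1 + q)\<^sup>2 - 4 * u\<^sup>2 \<ge> 49 / 25 * q\<^sup>2" if "p2 > 0"
  proof -
    have "(a * p2) * (b * p2) \<le> p1 * p3"
      using pos that by (intro mult_mono) auto
    moreover have "49 / 25 * p2\<^sup>2 \<le> (a * b) * p2\<^sup>2"
      using pos(5) by (intro mult_right_mono) auto
    ultimately have "49 / 25 * p2\<^sup>2 \<le> p1 * p3"
      by (simp add: power2_eq_square algebra_simps)
    also have "p1 * p3 = (A1 * A3) * ((1 + q)\<^sup>2 - 4 * u\<^sup>2)"
      by (simp add: p power2_eq_square algebra_simps)
    finally have "49 / 25 * (A2\<^sup>2 * q\<^sup>2) \<le> (A1 * A3) * ((1 + q)\<^sup>2 - 4 * u\<^sup>2)"
      by (simp add: p power_mult_distrib)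
    moreover have "(A1 * A3) * q\<^sup>2 \<le> A2\<^sup>2 * q\<^sup>2"
      using A(3) by (rule mult_right_mono) simp
    ultimately have "(A1 * A3) * (49 / 25 * q\<^sup>2) \<le> (A1 * A3) * ((1 + q)\<^sup>2 - 4 * u\<^sup>2)"
      by linarith
    thus ?thesis using A(1) by (simp only: mult_le_cancel_left_pos)
  qed
  \<comment> \<open>Otherwise both \<open>1 + 2 * u + q\<close> and \<open>1 - 2 * u + q\<close> are
    negative, so \<open>q < -1\<close> and \<open>(1 + q) ^ 2 < q ^ 2\<close>, against
    \<open>ratio\<close>.\<close>
  have A1: "A1 > 0"
  proof (rule ccontr)
    assume "\<not> A1 > 0"
    hence neg: "A1 < 0" "A2 < 0" "A3 < 0"
      using A(1,2) by (auto simp: zero_less_mult_iff)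
    hence "1 + 2 * u + q < 0" "1 - 2 * u + q < 0"
      using pos(1,2) by (auto simp: p zero_less_mult_iff)
    hence q: "q < -1" by linarith
    hence "p2 > 0" using neg by (auto simp: p zero_less_mult_iff)
    from ratio[OF this] have "49 / 25 * q\<^sup>2 \<le> (1 + q)\<^sup>2"
      by (smt (verit) zero_le_power2)
    moreover have "(1 + q)\<^sup>2 = q\<^sup>2 + (2 * q + 1)"
      by (simp add: power2_eq_square algebra_simps)
    ultimately show False using q zero_le_power2[of q] by linarith
  qed
  hence pos': "A2 > 0" "A3 > 0" using A(1,2) by (auto simp: zero_less_mult_iff)
  have k: "1 + 2 * u + q > 0" "1 - 2 * u + q > 0"
    using pos(1,2) A1 pos' by (auto simp: p zero_less_mult_iff)
  \<comment> \<open>As \<open>x * (x - 1) + B * x + g\<close> the quadratic has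
    \<open>B = 6 + 2 * u\<close> and \<open>g = 25 / 4 + 5 * u + q\<close>; this is
    \<open>B ^ 2 - 4 * g\<close>.\<close>
  have sq: "(6 + 2 * u)\<^sup>2 - 4 * (25 / 4 + 5 * u + q) = (2 * u + 1)\<^sup>2 + 10 - 4 * q"
    by (simp add: power2_eq_square algebra_simps)
  show ?thesis
  proof (cases "q \<le> 0")
    case True
    show ?thesis
      using True k sq zero_le_power2[of "2 * u + 1"] by (intro conjI; linarith)
  next
    case False
    hence "p2 > 0" using pos' by (simp add: p)
    from ratio[OF this] have r: "4 * u\<^sup>2 \<le> (1 + q)\<^sup>2 - 49 / 25 * q\<^sup>2" by simp
    \<comment> \<open>The constant 49/25 is the square of 7/5, chosen to yield
      \<open>q \<le> 5 / 2\<close>, which makes \<open>10 - 4 * q\<close> in \<open>sq\<close>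
      nonnegative.\<close>
    have "(7 / 5 * q)\<^sup>2 \<le> (1 + q)\<^sup>2"
    proof -
      have "(7 / 5 * q)\<^sup>2 = 49 / 25 * q\<^sup>2" by (simp add: power2_eq_square)
      thus ?thesis using r zero_le_power2[of u] by linarith
    qed
    hence "7 / 5 * q \<le> 1 + q"
      by (rule power2_le_imp_le) (use False in simp)
    hence q: "q \<le> 5 / 2" by simp
    \<comment> \<open>Completing the square bounds \<open>4 * u ^ 2\<close> by 49/24, which is below
      9/4.\<close>
    have "(2 * u)\<^sup>2 \<le> (3 / 2)\<^sup>2"
    proof -
      have "(1 + q)\<^sup>2 - 49 / 25 * q\<^sup>2 = 49 / 24 - 24 / 25 * (q - 25 / 24)\<^sup>2"
        by (simp add: power2_eq_square field_simps)
      moreover have "(2 * u)\<^sup>2 = 4 * u\<^sup>2" by simp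
      moreover have "(3 / 2 :: real)\<^sup>2 = 9 / 4" by (simp add: power2_eq_square)
      ultimately show ?thesis using r zero_le_power2[of "q - 25 / 24"] by linarith
    qed
    hence "\<bar>2 * u\<bar> \<le> 3 / 2"
      using abs_le_square_iff[of "2 * u" "3 / 2"] by simp
    hence "- (3 / 2) \<le> 2 * u" by (simp add: abs_le_iff)
    thus ?thesis
      using q False sq zero_le_power2[of "2 * u + 1"] by (intro conjI; linarith)
  qed
qed

text \<open>Of the \<open>2 * m - 2\<close> zeros, \<open>m - 1\<close> lie beyond \<open>d\<close>
  and \<open>m - 3\<close> below -7/2. The cofactor is thus quadratic with leading coefficient 1 or
  -1, and the values at -3/2, -5/2 and -7/2 locate it.\<close>

lemma n_sequence_f_seq_large:
  assumes m: "m \<ge> 3" and d: "d \<ge> 2"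
    and sgn: "\<And>k. k < m - 3 \<Longrightarrow> poly (fpoly d m) (- (real k + 7/2))
                 * poly (fpoly d m) (- (real (Suc k) + 7/2)) < 0"
    and pos: "poly (fpoly d m) (- (3/2)) > 0" "poly (fpoly d m) (- (7/2)) > 0"
    and ab: "a > 0" "b > 0" "a * b \<ge> 49 / 25"
      "poly (fpoly d m) (- (3/2)) \<ge> a * poly (fpoly d m) (- (5/2))"
      "poly (fpoly d m) (- (7/2)) \<ge> b * poly (fpoly d m) (- (5/2))"
  shows "n_sequence d (f_seq m d)"
proof -
  let ?P = "fpoly (real d) m"
  obtain R1 where R1: "finite R1" "card R1 = m - 1" "\<And>r. r \<in> R1 \<Longrightarrow> poly ?P r = 0 \<and> real d < r"
    using fpoly_left_roots[of "real d" m] m d by auto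
  obtain R2 where R2: "finite R2" "card R2 = m - 3" "\<And>r. r \<in> R2 \<Longrightarrow> poly ?P r = 0 \<and> r < - (7/2)"
    using sign_changes_imp_roots[of "m - 3" "\<lambda>k. - (real k + 7/2)" ?P] sgn by auto
  define R where "R = R1 \<union> R2"
  have disj: "R1 \<inter> R2 = {}" using R1(3) R2(3) by force
  have R: "finite R" "card R = 2 * m - 4"
    using R1 R2 disj m by (auto simp: R_def card_Un_disjoint)
  have out: "r > real d \<or> r < - (7/2)" if "r \<in> R" for r
    using that R1(3) R2(3) by (auto simp: R_def)
  obtain Q where Q: "?P = (\<Prod>r\<in>R. [:-r, 1:]) * Q"
    using poly_factor_roots[of R ?P] R R1(3) R2(3) by (auto simp: R_def)
  have "Suc (m - 1) = m" using m by simp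
  note deg = fpoly_degree[of "real d" "m - 1", unfolded this]
  have degP: "degree ?P = 2 * m - 2" "lead_coeff ?P = (-1) ^ (m - 1)"
    using conjunct1[OF deg] conjunct2[OF deg] by (simp, blast)
  have P0: "?P \<noteq> 0" using degP(2) by auto
  hence Q0: "Q \<noteq> 0" using Q by auto
  let ?A = "\<Prod>r\<in>R. [:-r, 1:]"
  have A0: "?A \<noteq> 0" using P0 Q by auto
  have "degree ?A = 2 * m - 4"
    using R by (subst degree_prod_eq_sum_degree) auto
  hence degQ: "degree Q = 2"
    using degree_mult_eq[OF A0 Q0] degP Q m by simp
  have "lead_coeff ?A = 1"
    by (simp add: lead_coeff_prod)
  hence lcQ: "lead_coeff Q = (-1) ^ (m - 1)"
    using degP(2) lead_coeff_mult[of ?A Q] Q by simp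
  define l where "l = (-1 :: real) ^ (m - 1)"
  have l: "l * l = 1" "l \<noteq> 0" by (auto simp: l_def simp flip: power_mult_distrib)
  \<comment> \<open>The cofactor, divided by its leading coefficient \<open>l\<close>, is expanded
    around -5/2; dividing by \<open>l\<close> is multiplying by it.\<close>
  define u where "u = (l * coeff Q 1 - 5) / 2"
  define q where "q = l * coeff Q 0 - 25 / 4 - 5 * u"
  have l_eq: "coeff Q 2 = l" using lcQ degQ by (simp add: l_def)
  have polyQ: "poly Q x = l * ((x + 5/2)\<^sup>2 + 2 * u * (x + 5/2) + q)" for x
  proof -
    have "poly Q x = coeff Q 0 + coeff Q 1 * x + l * x\<^sup>2"
      unfolding poly_altdef degQ by (simp add: numeral_2_eq_2 l_eq [unfolded numeral_2_eq_2])
    also have "coeff Q 0 = l * (l * coeff Q 0)" using l(1) by (simp flip: mult.assoc)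
    also have "coeff Q 1 = l * (l * coeff Q 1)" using l(1) by (simp flip: mult.assoc)
    also have "l * (l * coeff Q 0) + l * (l * coeff Q 1) * x + l * x\<^sup>2
        = l * (l * coeff Q 0 + l * coeff Q 1 * x + x\<^sup>2)"
      by (simp add: algebra_simps)
    also have "l * coeff Q 0 = q + 25 / 4 + 5 * u" by (simp add: q_def)
    also have "l * coeff Q 1 = 2 * u + 5" by (simp add: u_def field_simps)
    also have "q + 25 / 4 + 5 * u + (2 * u + 5) * x + x\<^sup>2 = (x + 5/2)\<^sup>2 + 2 * u * (x + 5/2) + q"
      by (simp add: power2_eq_square algebra_simps)
    finally show ?thesis .
  qed
  have PA: "poly ?P x = (l * (\<Prod>r\<in>R. x - r)) * ((x + 5/2)\<^sup>2 + 2 * u * (x + 5/2) + q)" for x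
    by (subst Q) (simp add: poly_prod polyQ)
  let ?A1 = "\<Prod>r\<in>R. - (3/2) - r" and ?A2 = "\<Prod>r\<in>R. - (5/2) - r" and ?A3 = "\<Prod>r\<in>R. - (7/2) - r"
  have *: "0 < (- (3/2) - r) * (- (7/2) - r)" "0 < (- (3/2) - r) * (- (5/2) - r)"
    "(- (3/2) - r) * (- (7/2) - r) \<le> (- (5/2) - r)\<^sup>2" if "r \<in> R" for r
  proof -
    have "r > 0 \<or> r < - (7/2)" using out[OF that] by auto
    thus "0 < (- (3/2) - r) * (- (7/2) - r)" "0 < (- (3/2) - r) * (- (5/2) - r)"
      by (auto simp: zero_less_mult_iff)
    show "(- (3/2) - r) * (- (7/2) - r) \<le> (- (5/2) - r)\<^sup>2"
      by (simp add: power2_eq_square algebra_simps)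
  qed
  have A13: "?A1 * ?A3 > 0"
    unfolding prod.distrib [symmetric] using * by (intro prod_pos) auto
  have A12: "?A1 * ?A2 > 0"
    unfolding prod.distrib [symmetric] using * by (intro prod_pos) auto
  have A132: "?A1 * ?A3 \<le> ?A2\<^sup>2"
    unfolding prod.distrib [symmetric] prod_power_distrib using *
    by (intro prod_mono) (auto intro: less_imp_le)
  have reg: "25 / 4 + 5 * u + q > 0 \<and> 6 + 2 * u > 0 \<and> (6 + 2 * u)\<^sup>2 \<ge> 4 * (25 / 4 + 5 * u + q)"
  proof (rule quadratic_region)
    have ll: "l * x * (l * y) = x * y" for x y
      using l(1) by (metis mult.assoc mult.left_commute mult_1_left)
    show "l * ?A1 * (l * ?A3) > 0" "l * ?A1 * (l * ?A2) > 0" "l * ?A1 * (l * ?A3) \<le> (l * ?A2)\<^sup>2"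
      using A13 A12 A132 unfolding power2_eq_square ll by blast+
    show "poly ?P (- (3/2)) = l * ?A1 * (1 + 2 * u + q)" "poly ?P (- (5/2)) = l * ?A2 * q"
      "poly ?P (- (7/2)) = l * ?A3 * (1 - 2 * u + q)"
      unfolding PA by (simp_all add: power2_eq_square)
  qed (use pos ab in auto)
  show ?thesis
  proof (rule n_sequence_fpoly[OF Q R(1)])
    show "r < 0 \<or> real d < r" if "r \<in> R" for r using out[OF that] by auto
    have "n_sequence d (\<lambda>i. l * ((real d - real i) * (real d - real i - 1)
        + (6 + 2 * u) * (real d - real i) + (25 / 4 + 5 * u + q)))"
      using reg d l by (intro n_sequence_mult n_sequence_const n_sequence_quadratic) auto
    moreover have "(\<lambda>i. poly Q (real d - real i)) = (\<lambda>i. l * ((real d - real i) * (real d - real i - 1)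
        + (6 + 2 * u) * (real d - real i) + (25 / 4 + 5 * u + q)))"
      by (simp add: polyQ fun_eq_iff power2_eq_square algebra_simps)
    ultimately show "n_sequence d (\<lambda>i. poly Q (real d - real i))" by simp
  qed (use d m in auto)
qed

subsection \<open>Large \<open>d\<close>\<close>

text \<open>Constant term first; the arithmetic stays on integer lists so that it can be evaluated
  by \<open>code_simp\<close>.\<close>

fun lpoly :: "int list \<Rightarrow> real \<Rightarrow> real" where
  "lpoly [] x = 0"
| "lpoly (c # cs) x = of_int c + x * lpoly cs x"

fun ladd :: "int list \<Rightarrow> int list \<Rightarrow> int list" where
  "ladd [] q = q"
| "ladd (a # p) [] = a # p"
| "ladd (a # p) (b # q) = (a + b) # ladd p q"

definition lscale :: "int \<Rightarrow> int list \<Rightarrow> int list" where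
  "lscale c p = map (\<lambda>a. c * a) p"

definition lmul_linear :: "int \<Rightarrow> int list \<Rightarrow> int list" where
  "lmul_linear a p = ladd (lscale a p) (0 # p)"

text \<open>Horner's scheme for the substitution of \<open>x + a\<close>.\<close>

fun lshift :: "int \<Rightarrow> int list \<Rightarrow> int list" where
  "lshift a [] = []"
| "lshift a (c # cs) = ladd [c] (lmul_linear a (lshift a cs))"

lemma lpoly_ladd: "lpoly (ladd p q) x = lpoly p x + lpoly q x"
  by (induction p q rule: ladd.induct) (auto simp: algebra_simps)

lemma lpoly_lscale: "lpoly (lscale c p) x = of_int c * lpoly p x"
  by (induction p) (auto simp: lscale_def algebra_simps)

lemma lpoly_lmul_linear: "lpoly (lmul_linear a p) x = (x + of_int a) * lpoly p x"
  by (simp add: lmul_linear_def lpoly_ladd lpoly_lscale algebra_simps)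

lemma lpoly_lshift: "lpoly (lshift a p) x = lpoly p (x + of_int a)"
  by (induction p) (auto simp: lpoly_ladd lpoly_lmul_linear)

lemma lpoly_nonneg: "list_all (\<lambda>c. c \<ge> 0) p \<Longrightarrow> x \<ge> 0 \<Longrightarrow> lpoly p x \<ge> 0"
  by (induction p) auto

text \<open>The lists for \<open>n = 1, \<dots>, k\<close> of the coefficients of \<open>fnum 2 n X Y\<close> as a polynomial in \<open>X\<close>.\<close>

fun fnum_lists :: "nat \<Rightarrow> int \<Rightarrow> int \<Rightarrow> int list \<Rightarrow> int list \<Rightarrow> int \<Rightarrow> int list list" where
  "fnum_lists 0 n Y W A r = []"
| "fnum_lists (Suc k) n Y W A r =
    (let W' = ladd (lscale (2 * n) (lmul_linear (2 * n + 2) W)) (lscale r A)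
     in W' # fnum_lists k (n + 1) Y W' (lmul_linear (2 * n) A) (r * (Y + 2 + 2 * n)))"

text \<open>The conditions on \<open>W\<close>, \<open>A\<close> and \<open>r\<close> form the loop
  invariant. Since \<open>Y\<close> is fixed, the rising product in \<open>Y\<close> is the single
  integer \<open>r\<close>.\<close>

lemma lpoly_fnum_lists:
  assumes "j < k" "\<And>X. lpoly W X = fnum 2 n X (of_int Y)" "\<And>X. lpoly A X = rise 2 n X"
    "real_of_int r = rise 2 n (of_int Y + 2)"
  shows "lpoly (fnum_lists k (int n) Y W A r ! j) X = fnum 2 (Suc (n + j)) X (of_int Y)"
  using assms
proof (induction k arbitrary: j n W A r)
  case (Suc k)
  let ?W = "ladd (lscale (2 * int n) (lmul_linear (2 * int n + 2) W)) (lscale r A)"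
  have W: "lpoly ?W X = fnum 2 (Suc n) X (of_int Y)" for X
    by (simp add: lpoly_ladd lpoly_lscale lpoly_lmul_linear Suc.prems algebra_simps)
  show ?case
  proof (cases j)
    case 0
    thus ?thesis using W by (simp add: Let_def)
  next
    case (Suc j')
    have "lpoly (fnum_lists k (int (Suc n)) Y ?W (lmul_linear (2 * int n) A) (r * (Y + 2 + 2 * int n)) ! j') X
        = fnum 2 (Suc (Suc n + j')) X (of_int Y)"
      using Suc Suc.prems(1)
      by (intro Suc.IH W) (simp_all add: lpoly_lmul_linear Suc.prems rise_Suc algebra_simps)
    thus ?thesis using Suc by (simp add: Let_def add.commute)
  qed
qed simp

text \<open>The thresholds and ratios are chosen such that, after the substitution \<open>d = threshold m + x\<close>,
  all polynomials in \<open>x\<close> arising below have coefficients of constant sign; \<open>ratio m / 5\<close> bounds the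
  quotient of the values at \<open>-3/2\<close> and \<open>-5/2\<close> from below.\<close>

definition threshold :: "nat \<Rightarrow> nat" where
  "threshold m = [0, 0, 0, 2, 4, 6, 9, 11, 15, 18, 22, 26, 29, 33, 36, 40] ! m"

definition ratio :: "nat \<Rightarrow> int" where
  "ratio m = [1, 1, 1, 7, 14, 19, 24, 28, 32, 36, 40, 44, 49, 53, 57, 61] ! m"

definition half_lists :: "int \<Rightarrow> int list list" where
  "half_lists C = fnum_lists 15 0 (- C) [] [1] 1"

text \<open>At \<open>j = - C / 2\<close> the doubled arguments are \<open>Y = - C\<close> and
  \<open>X = 2 * d + C\<close>. The shift makes \<open>2 * (d - threshold m)\<close> the variable,
  so \<open>d \<ge> threshold m\<close> becomes nonnegativity.\<close>

definition half_poly :: "int list list \<Rightarrow> int \<Rightarrow> nat \<Rightarrow> int list" where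
  "half_poly Ws C m = lshift (2 * int (threshold m) + C) (Ws ! (m - 1))"

text \<open>The nonzero constant coefficient makes the sign strict even at 0.\<close>

definition signed :: "bool \<Rightarrow> int list \<Rightarrow> bool" where
  "signed s p \<longleftrightarrow> list_all (\<lambda>c. if s then c \<ge> 0 else c \<le> 0) p \<and> hd p \<noteq> 0 \<and> p \<noteq> []"

text \<open>Tests the sign at \<open>- (k + 1/2)\<close>: positive for odd \<open>k\<close>,
  negative for even \<open>k\<close>. The case \<open>k = 2\<close> is never tested, because the
  sign at -5/2 is left open.\<close>

definition right_ok :: "nat \<Rightarrow> bool" where
  "right_ok k \<longleftrightarrow> (let Ws = half_lists (2 * int k + 1)
     in list_all (\<lambda>m. signed (odd k) (half_poly Ws (2 * int k + 1) m)) [max 3 k..<16])"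

text \<open>These are the comparisons in \<open>n_sequence_f_seq_large\<close> for
  \<open>a = ratio m / 5\<close> and \<open>b = 49 / (5 * ratio m)\<close>, cleared of denominators;
  this choice gives exactly \<open>a * b = 49 / 25\<close>.\<close>

definition ratio_ok :: bool where
  "ratio_ok \<longleftrightarrow> (let W3 = half_lists 3; W5 = half_lists 5; W7 = half_lists 7 in
     list_all (\<lambda>m. let p1 = half_poly W3 3 m; p2 = half_poly W5 5 m; p3 = half_poly W7 7 m in
       list_all (\<lambda>c. c \<ge> 0) (ladd (lscale 5 p1) (lscale (- ratio m) p2)) \<and>
       list_all (\<lambda>c. c \<ge> 0) (ladd (lscale (5 * ratio m) p3) (lscale (- 49) p2))) [3..<16])"

lemma right_ok_1: "right_ok 1"
  by code_simp

lemma right_ok_3: "right_ok 3"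
  by code_simp

lemma right_ok_4: "right_ok 4"
  by code_simp

lemma right_ok_5: "right_ok 5"
  by code_simp

lemma right_ok_6: "right_ok 6"
  by code_simp

lemma right_ok_7: "right_ok 7"
  by code_simp

lemma right_ok_8: "right_ok 8"
  by code_simp

lemma right_ok_9: "right_ok 9"
  by code_simp

lemma right_ok_10: "right_ok 10"
  by code_simp

lemma right_ok_11: "right_ok 11"
  by code_simp

lemma right_ok_12: "right_ok 12"
  by code_simp

lemma right_ok_13: "right_ok 13"
  by code_simp

lemma right_ok_14: "right_ok 14"
  by code_simp

lemma right_ok_15: "right_ok 15"
  by code_simp

lemma ratio_ok: ratio_ok
  by code_simp

lemma signed_lpoly:
  assumes "signed s p" "x \<ge> 0"
  shows "if s then lpoly p x > 0 else lpoly p x < 0"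
proof -
  obtain c cs where p: "p = c # cs" using assms by (cases p) (auto simp: signed_def)
  have nonpos: "lpoly q x \<le> 0" if "list_all (\<lambda>c. c \<le> 0) q" for q
    using that assms(2) by (induction q) (auto intro: add_nonpos_nonpos mult_nonneg_nonpos)
  show ?thesis
  proof (cases s)
    case True
    hence "c > 0" "list_all (\<lambda>c. c \<ge> 0) cs" using assms by (auto simp: signed_def p)
    moreover from this have "x * lpoly cs x \<ge> 0"
      using assms(2) lpoly_nonneg by simp
    ultimately show ?thesis using True by (simp add: p)
  next
    case False
    hence "c < 0" "list_all (\<lambda>c. c \<le> 0) cs" using assms by (auto simp: signed_def p)
    moreover from this have "x * lpoly cs x \<le> 0"
      using assms(2) nonpos by (intro mult_nonneg_nonpos) auto
    ultimately show ?thesis using False by (simp add: p)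
  qed
qed

text \<open>The power of 4 comes from \<open>fnum_scale\<close> with step 2.\<close>

lemma fpoly_half:
  assumes m: "1 \<le> m" "m \<le> 15"
  shows "4 ^ (m - 1) * poly (fpoly (real d) m) (- (real_of_int C / 2))
    = lpoly (half_poly (half_lists C) C m) (2 * (real d - real (threshold m)))"
proof -
  let ?x = "real d + real_of_int C / 2" and ?y = "- (real_of_int C / 2)"
  have "lpoly (half_poly (half_lists C) C m) (2 * (real d - real (threshold m)))
      = lpoly (half_lists C ! (m - 1)) (2 * real d + real_of_int C)"
    by (simp add: half_poly_def lpoly_lshift algebra_simps)
  also have "\<dots> = fnum 2 (Suc (m - 1)) (2 * real d + real_of_int C) (- real_of_int C)"
    using lpoly_fnum_lists[of "m - 1" 15 "[]" 0 "- C" "[1]" 1] m by (simp add: half_lists_def rise_def)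
  also have "\<dots> = fnum 2 (Suc (m - 1)) (2 * ?x) (2 * ?y)"
    by (simp add: algebra_simps)
  also have "\<dots> = 2 ^ (2 * (m - 1)) * fnum 1 (Suc (m - 1)) ?x ?y"
    by (rule fnum_scale)
  also have "\<dots> = 4 ^ (m - 1) * poly (fpoly (real d) m) ?y"
    using m by (simp add: poly_fpoly power_mult)
  finally show ?thesis ..
qed

lemma fpoly_half_sign:
  assumes "right_ok k" "3 \<le> m" "k \<le> m" "m \<le> 15" "threshold m \<le> d"
  shows "if odd k then poly (fpoly (real d) m) (- (real k + 1/2)) > 0
    else poly (fpoly (real d) m) (- (real k + 1/2)) < 0"
proof -
  let ?C = "2 * int k + 1"
  let ?v = "poly (fpoly (real d) m) (- (real k + 1/2))"
  have "m \<in> set [max 3 k..<16]" unfolding set_upt using assms by auto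
  hence "signed (odd k) (half_poly (half_lists ?C) ?C m)"
    using assms(1) unfolding right_ok_def Let_def list_all_iff by blast
  hence "if odd k then lpoly (half_poly (half_lists ?C) ?C m) (2 * (real d - real (threshold m))) > 0
    else lpoly (half_poly (half_lists ?C) ?C m) (2 * (real d - real (threshold m))) < 0"
    by (rule signed_lpoly) (use assms in simp)
  moreover have "- (real_of_int ?C / 2) = - (real k + 1/2)" by (simp add: field_simps)
  ultimately have "if odd k then 4 ^ (m - 1) * ?v > 0 else 4 ^ (m - 1) * ?v < 0"
    using fpoly_half[of m d ?C] assms by (simp only:)
  thus ?thesis by (simp add: zero_less_mult_iff mult_less_0_iff split: if_splits)
qed

lemma fpoly_half_ratio:
  assumes "3 \<le> m" "m \<le> 15" "threshold m \<le> d"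
  shows "5 * poly (fpoly (real d) m) (- (3/2)) \<ge> ratio m * poly (fpoly (real d) m) (- (5/2))"
    "5 * ratio m * poly (fpoly (real d) m) (- (7/2)) \<ge> 49 * poly (fpoly (real d) m) (- (5/2))"
proof -
  define x where "x = 2 * (real d - real (threshold m))"
  let ?h = "\<lambda>C. half_poly (half_lists C) C m"
  let ?v = "\<lambda>y. poly (fpoly (real d) m) (- y)"
  have x: "x \<ge> 0" using assms by (simp add: x_def)
  have eq: "lpoly (?h 3) x = 4 ^ (m - 1) * ?v (3/2)" "lpoly (?h 5) x = 4 ^ (m - 1) * ?v (5/2)"
    "lpoly (?h 7) x = 4 ^ (m - 1) * ?v (7/2)"
    using fpoly_half[of m d 3] fpoly_half[of m d 5] fpoly_half[of m d 7] assms
    by (simp_all add: x_def)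
  have "m \<in> set [3..<16]" unfolding set_upt using assms by auto
  hence "list_all (\<lambda>c. c \<ge> 0) (ladd (lscale 5 (?h 3)) (lscale (- ratio m) (?h 5)))"
    "list_all (\<lambda>c. c \<ge> 0) (ladd (lscale (5 * ratio m) (?h 7)) (lscale (- 49) (?h 5)))"
    using ratio_ok unfolding ratio_ok_def Let_def list_all_iff by blast+
  from this[THEN lpoly_nonneg, OF x]
  have "0 \<le> 4 ^ (m - 1) * (5 * ?v (3/2) - ratio m * ?v (5/2))"
    "0 \<le> 4 ^ (m - 1) * (5 * ratio m * ?v (7/2) - 49 * ?v (5/2))"
    by (simp_all add: lpoly_ladd lpoly_lscale eq algebra_simps)
  moreover have "0 \<le> t" if "0 \<le> 4 ^ (m - 1) * t" for t :: real
    by (rule mult_left_le_imp_le[of "4 ^ (m - 1)"]) (use that in simp_all)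
  ultimately show "5 * ?v (3/2) \<ge> ratio m * ?v (5/2)" "5 * ratio m * ?v (7/2) \<ge> 49 * ?v (5/2)"
    by (metis diff_ge_0_iff_ge)+
qed

lemma right_ok:
  assumes "k = 1 \<or> 3 \<le> k" "k \<le> 15"
  shows "right_ok k"
proof -
  have "k = 1 \<or> k = 3 \<or> k = 4 \<or> k = 5 \<or> k = 6 \<or> k = 7 \<or> k = 8 \<or> k = 9 \<or> k = 10
      \<or> k = 11 \<or> k = 12 \<or> k = 13 \<or> k = 14 \<or> k = 15"
    using assms by presburger
  thus ?thesis
    using right_ok_1 right_ok_3 right_ok_4 right_ok_5 right_ok_6 right_ok_7 right_ok_8 right_ok_9
      right_ok_10 right_ok_11 right_ok_12 right_ok_13 right_ok_14 right_ok_15 by auto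
qed

lemma threshold_ratio_pos:
  assumes "3 \<le> m" "m \<le> 15"
  shows "threshold m \<ge> 2 \<and> ratio m > 0"
proof -
  have "list_all (\<lambda>m. threshold m \<ge> 2 \<and> ratio m > 0) [3..<16]" by code_simp
  moreover have "m \<in> set [3..<16]" unfolding set_upt using assms by auto
  ultimately show ?thesis unfolding list_all_iff by blast
qed

lemma n_sequence_above_threshold:
  assumes m: "3 \<le> m" "m \<le> 15" and d: "threshold m \<le> d"
  shows "n_sequence d (f_seq m d)"
proof (rule n_sequence_f_seq_large)
  let ?v = "\<lambda>y. poly (fpoly (real d) m) (- y)"
  let ?a = "real_of_int (ratio m)"
  note sgn = fpoly_half_sign[OF right_ok m(1) _ m(2) d]
  have a: "?a > 0" using threshold_ratio_pos[OF m] by simp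
  show "d \<ge> 2" using threshold_ratio_pos[OF m] d by simp
  show "?v (3/2) > 0" using sgn[of 1] m by simp
  show "?v (7/2) > 0" using sgn[of 3] m by simp
  show "?v (real k + 7/2) * ?v (real (Suc k) + 7/2) < 0" if "k < m - 3" for k
  proof -
    have "k + 3 + 1/2 = real k + 7/2" "(k + 4) + 1/2 = real (Suc k) + 7/2" by simp_all
    thus ?thesis
      using sgn[of "k + 3"] sgn[of "k + 4"] that m
      by (cases "odd k") (auto simp: mult_less_0_iff algebra_simps)
  qed
  show "?a / 5 > 0" "49 / (5 * ?a) > 0" "49 / 25 \<le> ?a / 5 * (49 / (5 * ?a))"
    using a by simp_all
  show "?a / 5 * ?v (5/2) \<le> ?v (3/2)" "49 / (5 * ?a) * ?v (5/2) \<le> ?v (7/2)"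
    using fpoly_half_ratio[OF m d] a by (simp_all add: field_simps)
qed (use m in simp)

subsection \<open>Small \<open>d\<close>\<close>

text \<open>Forward evaluation of the recurrence: \<open>W\<close> carries
  \<open>fnum 1 n i j\<close> and \<open>A\<close> the product of the two rising factors, so that
  nothing is recomputed.\<close>

fun fnum_loop :: "nat \<Rightarrow> int \<Rightarrow> int \<Rightarrow> int \<Rightarrow> int \<Rightarrow> int \<Rightarrow> int" where
  "fnum_loop 0 n i j W A = W"
| "fnum_loop (Suc k) n i j W A =
     fnum_loop k (n + 1) i j (n * (i + n + 1) * W + A) (A * (i + n) * (j + 1 + n))"

lemma fnum_loop_eq:
  "fnum_loop k (int n) i j (fnum 1 n i j) (rise 1 n i * rise 1 n (j + 1)) = fnum 1 (n + k) i j"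
proof (induction k arbitrary: n)
  case (Suc k)
  have "fnum_loop (Suc k) (int n) i j (fnum 1 n i j) (rise 1 n i * rise 1 n (j + 1))
      = fnum_loop k (int (Suc n)) i j (fnum 1 (Suc n) i j) (rise 1 (Suc n) i * rise 1 (Suc n) (j + 1))"
    by (simp add: rise_Suc algebra_simps)
  thus ?case using Suc.IH[of "Suc n"] by (simp only: add_Suc add_Suc_right)
qed simp

text \<open>The argument \<open>b\<close> carries \<open>d choose i\<close>; its update is an exact
  division.\<close>

fun coeff_list :: "nat \<Rightarrow> nat \<Rightarrow> int \<Rightarrow> int \<Rightarrow> int \<Rightarrow> int list" where
  "coeff_list 0 m d i b = []"
| "coeff_list (Suc k) m d i b =
     b * fnum_loop m 0 i (d - i) 0 1 # coeff_list k m d (i + 1) (b * (d - i) div (i + 1))"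

lemma coeff_list_nth:
  assumes "j < k" "i + k \<le> Suc d"
  shows "coeff_list k m (int d) (int i) (int (d choose i)) ! j
    = int (d choose (i + j)) * fnum 1 m (int (i + j)) (int d - int (i + j))"
  using assms
proof (induction k arbitrary: i j)
  case (Suc k)
  have loop: "fnum_loop m 0 x y 0 1 = fnum 1 m x y" for x y
    using fnum_loop_eq[of m 0 x y] by (simp add: rise_def)
  have "i \<le> d" using Suc.prems by simp
  hence "int (d choose i) * (int d - int i) = int ((d choose i) * (d - i))"
    by (simp add: of_nat_diff)
  also have "(d choose i) * (d - i) = (d choose Suc i) * Suc i"
    by (metis binomial_absorption binomial_absorb_comp mult.commute)
  finally have "int (d choose i) * (int d - int i) = int (d choose Suc i) * (int i + 1)"
    by (simp only: of_nat_mult of_nat_Suc add.commute)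
  hence b: "int (d choose i) * (int d - int i) div (int i + 1) = int (d choose Suc i)"
    by (metis nonzero_mult_div_cancel_right of_nat_Suc add.commute of_nat_eq_0_iff nat.distinct(1))
  show ?case
  proof (cases j)
    case (Suc j')
    have "coeff_list k m (int d) (int (Suc i)) (int (d choose Suc i)) ! j'
      = int (d choose (Suc i + j')) * fnum 1 m (int (Suc i + j')) (int d - int (Suc i + j'))"
      using Suc Suc.prems by (intro Suc.IH) auto
    thus ?thesis using Suc b by (simp add: add.commute)
  qed (simp add: loop)
qed simp

lemma length_coeff_list: "length (coeff_list k m d i b) = k"
  by (induction k arbitrary: i b) auto

text \<open>Horner evaluation at \<open>- p / q\<close> without fractions: for a nonempty list the
  first component is the value times \<open>q ^ (length - 1)\<close>, the second is
  \<open>q ^ length\<close>.\<close>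

fun hom_eval :: "int \<Rightarrow> int \<Rightarrow> int list \<Rightarrow> int \<times> int" where
  "hom_eval p q [] = (0, 1)"
| "hom_eval p q (c # cs) = (case hom_eval p q cs of (v, w) \<Rightarrow> (c * w - p * v, w * q))"

lemma snd_hom_eval: "snd (hom_eval p q cs) = q ^ length cs"
  by (induction cs) (auto split: prod.splits)

lemma fst_hom_eval:
  assumes "q \<noteq> 0"
  shows "real_of_int (fst (hom_eval p q cs)) * of_int q = of_int q ^ length cs * lpoly cs (- (p / q))"
proof (induction cs)
  case (Cons c cs)
  let ?v = "real_of_int (fst (hom_eval p q cs))" and ?L = "lpoly cs (- (p / q))"
  have "real_of_int (fst (hom_eval p q (c # cs))) * of_int q
      = (of_int c * of_int q ^ length cs - of_int p * ?v) * of_int q"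
    using snd_hom_eval[of p q cs] by (simp add: case_prod_unfold)
  also have "\<dots> = of_int q ^ Suc (length cs) * of_int c - of_int p * (?v * of_int q)"
    by (simp add: algebra_simps)
  also have "of_int p * (?v * of_int q) = of_int q ^ Suc (length cs) * (p / q * ?L)"
    unfolding Cons.IH using assms by simp
  finally show ?case by (simp add: algebra_simps)
qed simp

text \<open>For \<open>p = 1\<close> the reversed list is evaluated at \<open>- q\<close>, which avoids large powers of \<open>q\<close>.\<close>

definition point_value :: "int \<Rightarrow> int \<Rightarrow> int list \<Rightarrow> int" where
  "point_value p q P =
     (if p = 1 then (let v = fst (hom_eval q 1 (rev P)) in if odd (length P) then v else - v)
      else fst (hom_eval p q P))"

lemma lpoly_append: "lpoly (cs @ [c]) x = lpoly cs x + of_int c * x ^ length cs"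
  by (induction cs) (auto simp: algebra_simps)

lemma lpoly_rev:
  assumes "x \<noteq> 0"
  shows "lpoly (rev P) x * x = x ^ length P * lpoly P (1 / x)"
proof (induction P)
  case (Cons c P)
  have "lpoly (rev (c # P)) x * x = lpoly (rev P) x * x + of_int c * x ^ length (c # P)"
    by (simp add: lpoly_append algebra_simps)
  thus ?case unfolding Cons.IH using assms by (simp add: algebra_simps)
qed simp

text \<open>Both branches differ from the value of \<open>P\<close> by a positive power of
  \<open>q\<close>; for \<open>p = 1\<close> the parity test removes the sign of
  \<open>(- q) ^ (length P - 1)\<close>.\<close>

lemma sgn_point_value:
  assumes p: "p > 0" and q: "q > 0"
  shows "sgn (real_of_int (point_value p q P)) = sgn (lpoly P (- (p / q)))"
proof -
  have pow: "sgn (real_of_int q ^ length P) = 1" "sgn (real_of_int q) = 1"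
    using q by simp_all
  show ?thesis
  proof (cases "p = 1")
    case True
    let ?v = "fst (hom_eval q 1 (rev P))"
    have "real_of_int ?v = lpoly (rev P) (- q)"
      using fst_hom_eval[of 1 q "rev P"] by simp
    hence "real_of_int ?v * q = - ((- of_int q) ^ length P * lpoly P (- (1 / q)))"
      using lpoly_rev[of "- of_int q" P] q by simp
    hence "real_of_int (point_value p q P) * q = of_int q ^ length P * lpoly P (- (p / q))"
      using True by (simp add: point_value_def Let_def power_minus_odd)
    hence "sgn (real_of_int (point_value p q P) * q) = sgn (of_int q ^ length P * lpoly P (- (p / q)))"
      by simp
    thus ?thesis using pow by (simp add: sgn_mult)
  next
    case False
    hence "real_of_int (point_value p q P) * q = of_int q ^ length P * lpoly P (- (p / q))"
      using fst_hom_eval[of q p P] q by (simp add: point_value_def)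
    hence "sgn (real_of_int (point_value p q P) * q) = sgn (of_int q ^ length P * lpoly P (- (p / q)))"
      by simp
    thus ?thesis using pow by (simp add: sgn_mult)
  qed
qed

text \<open>The points \<open>- p / q\<close> move leftwards, so \<open>p / q\<close> increases;
  \<open>s\<close> says whether the value at the first one must be positive.\<close>

fun alternating :: "bool \<Rightarrow> int list \<Rightarrow> (int \<times> int) list \<Rightarrow> bool" where
  "alternating s P [] \<longleftrightarrow> True"
| "alternating s P ((p, q) # ps) \<longleftrightarrow> p > 0 \<and> q > 0 \<and>
     (let v = point_value p q P in if s then v > 0 else v < 0) \<and>
     (case ps of [] \<Rightarrow> True | (p', q') # _ \<Rightarrow> p * q' < p' * q) \<and> alternating (\<not> s) P ps"

text \<open>Synthetic division by \<open>1 + t\<close> from the constant term upwards, with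
  \<open>r\<close> the previous quotient coefficient. The remainder is ignored here;
  \<open>splits_ok\<close> verifies the quotient by multiplying back.\<close>

fun ldiv :: "int \<Rightarrow> int list \<Rightarrow> int list" where
  "ldiv r [] = []"
| "ldiv r [c] = []"
| "ldiv r (c # c' # cs) = (c - r) # ldiv (c - r) (c' # cs)"

text \<open>The argument \<open>e\<close> counts how often the factor \<open>1 + t\<close> is to be divided out first.\<close>

fun splits_ok :: "nat \<Rightarrow> int list \<Rightarrow> (int \<times> int) list \<Rightarrow> bool" where
  "splits_ok 0 P ps \<longleftrightarrow> length P = length ps + 2 \<and> hd P > 0 \<and> last P > 0 \<and> alternating False P ps"
| "splits_ok (Suc e) P ps \<longleftrightarrow> (let Q = ldiv 0 P in lmul_linear 1 Q = P \<and> splits_ok e Q ps)"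

text \<open>For a sequence of degree \<open>D\<close> in \<open>d - i\<close> the binomial
  polynomial is divisible by \<open>(1 + t) ^ (d - D)\<close>. Here \<open>D = 2 * m - 2\<close>,
  and truncated subtraction asks for no division if \<open>d \<le> D\<close>.\<close>

fun small_ok :: "nat \<Rightarrow> nat \<Rightarrow> (int \<times> int) list list \<Rightarrow> bool" where
  "small_ok m d [] \<longleftrightarrow> True"
| "small_ok m d (ps # pss) \<longleftrightarrow>
     splits_ok (d - (2 * m - 2)) (coeff_list (Suc d) m (int d) 0 1) ps \<and> small_ok m (Suc d) pss"

lemma poly_Poly_of_int: "poly (Poly (map real_of_int P)) x = lpoly P x"
  by (induction P) auto

lemma Poly_lmul_linear:
  "Poly (map real_of_int (lmul_linear 1 Q)) = [:1, 1:] * Poly (map real_of_int Q)"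
proof -
  have "poly (Poly (map real_of_int (lmul_linear 1 Q))) x = poly ([:1, 1:] * Poly (map real_of_int Q)) x" for x
    by (simp add: poly_Poly_of_int lpoly_lmul_linear algebra_simps)
  thus ?thesis by (simp add: poly_eq_poly_eq_iff [symmetric] fun_eq_iff)
qed

definition ratio_of :: "int \<times> int \<Rightarrow> real" where
  "ratio_of z = real_of_int (fst z) / real_of_int (snd z)"

lemma alternating_nth:
  assumes "alternating s P ps" "k < length ps"
  shows "fst (ps ! k) > 0 \<and> snd (ps ! k) > 0 \<and>
    (if s = even k then lpoly P (- ratio_of (ps ! k)) > 0 else lpoly P (- ratio_of (ps ! k)) < 0) \<and>
    (Suc k < length ps \<longrightarrow> ratio_of (ps ! k) < ratio_of (ps ! Suc k))"
  using assms
proof (induction s P ps arbitrary: k rule: alternating.induct)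
  case (2 s P p q ps)
  show ?case
  proof (cases k)
    case 0
    have q: "q > 0" and p: "p > 0" using 2 by auto
    let ?v = "point_value p q P" and ?l = "lpoly P (- (p / q))"
    have v: "if s then ?v > 0 else ?v < 0" using 2 by (simp add: Let_def)
    hence l: "if s then ?l > 0 else ?l < 0"
      using sgn_point_value[OF p q, of P]
      by (smt (verit) of_int_0_less_iff of_int_less_0_iff sgn_1_pos sgn_1_neg sgn_pos sgn_neg)
    have lt: "ratio_of (p, q) < ratio_of (ps ! 0)" if "0 < length ps"
    proof -
      obtain p' q' ps' where ps: "ps = (p', q') # ps'" using \<open>0 < length ps\<close> by (cases ps) auto
      hence "q' > 0" "p * q' < p' * q" using 2 by auto
      moreover from this have "real_of_int p * q' < p' * q" by (metis of_int_less_iff of_int_mult)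
      ultimately show ?thesis using q by (simp add: ps ratio_of_def field_simps)
    qed
    show ?thesis using 0 p q l lt by (cases s) (auto simp: ratio_of_def)
  next
    case (Suc k')
    thus ?thesis using 2 by (cases s; cases "even k'") auto
  qed
qed simp

text \<open>The degree is one more than the number of zeros found. The remaining linear factor
  \<open>[:a, b:]\<close> has \<open>b > 0\<close> by the leading coefficient and
  \<open>a > 0\<close> by the value at 0, so its zero is negative too.\<close>

lemma splits_if_alternating:
  assumes len: "length P = length ps + 2" and hd: "hd P > 0" and last: "last P > 0"
    and alt: "alternating False P ps"
  shows "\<exists>rs c. c \<noteq> 0 \<and> length rs = length P - 1 \<and> (\<forall>r\<in>set rs. r > 0) \<and>
    Poly (map real_of_int P) = smult c (\<Prod>r\<leftarrow>rs. [:r, 1:])"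
proof -
  define p where "p = Poly (map real_of_int P)"
  have P: "P \<noteq> []" using len by auto
  have cs: "coeffs p = map real_of_int P"
    using last P by (simp add: p_def strip_while_idem_iff no_trailing_unfold last_map)
  have degp: "degree p = length ps + 1"
    using len degree_eq_length_coeffs[of p] by (simp add: cs)
  have lcp: "lead_coeff p > 0"
  proof -
    have "p \<noteq> 0" using cs P by auto
    hence "lead_coeff p = last (map real_of_int P)"
      using last_coeffs_eq_coeff_degree[of p] cs by simp
    thus ?thesis using last P by (simp add: last_map)
  qed
  have "lpoly P 0 = hd P" using P by (cases P) auto
  hence p0: "poly p 0 > 0" using hd by (simp add: p_def poly_Poly_of_int)
  \<comment> \<open>The origin is prepended; there the value \<open>hd P\<close> is positive, so the
    first listed point must give a negative one.\<close>
  define x where "x k = (if k = 0 then 0 else - ratio_of (ps ! (k - 1)))" for k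
  have "x (Suc k) < x k \<and> poly p (x k) * poly p (x (Suc k)) < 0" if k: "k < length ps" for k
  proof (cases k)
    case 0
    thus ?thesis using alternating_nth[OF alt, of 0] k p0
      by (auto simp: x_def mult_less_0_iff p_def poly_Poly_of_int ratio_of_def)
  next
    case (Suc k')
    thus ?thesis using alternating_nth[OF alt, of k'] alternating_nth[OF alt, of k] k
      by (auto simp: x_def mult_less_0_iff p_def poly_Poly_of_int split: if_splits)
  qed
  then obtain R where R: "finite R" "card R = length ps" "\<And>r. r \<in> R \<Longrightarrow> poly p r = 0 \<and> r < 0"
    using sign_changes_imp_roots[of "length ps" x p] by (auto simp: x_def)
  obtain Q where Q: "p = (\<Prod>r\<in>R. [:-r, 1:]) * Q"
    using poly_factor_roots[of R p] R by auto
  let ?A = "\<Prod>r\<in>R. [:-r, 1:]"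
  have p_nz: "p \<noteq> 0" using lcp by auto
  hence nz: "?A \<noteq> 0" "Q \<noteq> 0" using Q by auto
  have "degree ?A = length ps"
    using R by (subst degree_prod_eq_sum_degree) auto
  hence degQ: "degree Q = 1"
    using degree_mult_eq[OF nz] degp Q by simp
  then obtain a b where Qab: "Q = [:a, b:]" "b \<noteq> 0" using degree1_coeffs by blast
  have "lead_coeff ?A = 1" by (simp add: lead_coeff_prod)
  hence b: "b > 0" using lead_coeff_mult[of ?A Q] Q lcp Qab by simp
  have "poly p 0 = (\<Prod>r\<in>R. - r) * a" by (subst Q) (simp add: poly_prod Qab)
  moreover have "(\<Prod>r\<in>R. - r) > 0" using R by (intro prod_pos) auto
  ultimately have a: "a > 0" using p0 by (simp add: zero_less_mult_iff)
  define rs where "rs = a / b # map uminus (sorted_list_of_set R)"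
  have "(\<Prod>r\<leftarrow>map uminus (sorted_list_of_set R). [:r, 1:]) = ?A"
    using R(1) prod.distinct_set_conv_list[of "sorted_list_of_set R" "\<lambda>r. [:-r, 1:]"]
    by (simp add: comp_def)
  hence "smult b (\<Prod>r\<leftarrow>rs. [:r, 1:]) = smult b [:a / b, 1:] * ?A"
    by (simp add: rs_def del: mult_pCons_left smult_pCons)
  also have "\<dots> = p" using b by (subst Q) (simp add: Qab mult.commute del: mult_pCons_left mult_pCons_right)
  finally have "p = smult b (\<Prod>r\<leftarrow>rs. [:r, 1:])" ..
  moreover have "length rs = length P - 1" using R len by (simp add: rs_def)
  moreover have "\<forall>r\<in>set rs. r > 0" using R a b by (auto simp: rs_def)
  ultimately have "b \<noteq> 0 \<and> length rs = length P - 1 \<and> (\<forall>r\<in>set rs. r > 0) \<and>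
      p = smult b (\<Prod>r\<leftarrow>rs. [:r, 1:])" using Qab(2) by simp
  thus ?thesis unfolding p_def by (intro exI)
qed

lemma splits_ok_imp_splits:
  assumes "splits_ok e P ps"
  shows "\<exists>rs c. c \<noteq> 0 \<and> length rs = length P - 1 \<and> (\<forall>r\<in>set rs. r > 0) \<and>
    Poly (map real_of_int P) = smult c (\<Prod>r\<leftarrow>rs. [:r, 1:])"
  using assms
proof (induction e arbitrary: P)
  case 0
  thus ?case by (intro splits_if_alternating) auto
next
  case (Suc e)
  define Q where "Q = ldiv 0 P"
  have Q: "lmul_linear 1 Q = P" "splits_ok e Q ps" using Suc.prems by (auto simp: Q_def Let_def)
  have "length (ladd p (a # p)) = Suc (length p)" for a p
    by (induction p arbitrary: a) auto
  hence len: "length P = Suc (length Q)"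
    using Q(1) by (auto simp: lmul_linear_def lscale_def)
  obtain rs c where rs: "c \<noteq> 0" "length rs = length Q - 1" "\<forall>r\<in>set rs. r > 0"
    "Poly (map real_of_int Q) = smult c (\<Prod>r\<leftarrow>rs. [:r, 1:])"
    using Suc.IH[OF Q(2)] by blast
  \<comment> \<open>Excludes an empty quotient, for which \<open>length Q - 1\<close> would be
    truncated.\<close>
  have "\<not> splits_ok e [] ps" by (cases e) (auto simp: lmul_linear_def lscale_def)
  hence "length Q > 0" using Q(2) by (cases Q) auto
  moreover have "Poly (map real_of_int P) = smult c (\<Prod>r\<leftarrow>1 # rs. [:r, 1:])"
    using Poly_lmul_linear[of Q] rs(4) by (simp add: Q(1) del: mult_pCons_left)
  ultimately show ?case
    using rs len by (intro exI[of _ "1 # rs"] exI[of _ c]) auto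
qed

text \<open>The list holds the coefficients of \<open>binomial_poly d (f_seq m d)\<close> times
  \<open>fact m * fact (m - 1)\<close>, a factor that the constant \<open>c\<close> absorbs.\<close>

lemma n_sequence_if_splits_ok:
  assumes ok: "splits_ok e (coeff_list (Suc d) m (int d) 0 1) ps" and m: "m > 0"
  shows "n_sequence d (f_seq m d)"
proof -
  let ?P = "coeff_list (Suc d) m (int d) 0 1"
  obtain rs c where rs: "c \<noteq> 0" "length rs = length ?P - 1" "\<forall>r\<in>set rs. r > 0"
    "Poly (map real_of_int ?P) = smult c (\<Prod>r\<leftarrow>rs. [:r, 1:])"
    using splits_ok_imp_splits[OF ok] by blast
  have nth: "?P ! i = int (d choose i) * fnum 1 m (int i) (int d - int i)" if "i \<le> d" for i
    using coeff_list_nth[of i "Suc d" 0 d m] that by simp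
  have len: "length ?P = Suc d" by (simp only: length_coeff_list)
  let ?K = "fact m * fact (m - 1) :: real"
  have "Poly (map real_of_int ?P) = smult ?K (binomial_poly d (f_seq m d))"
  proof (rule poly_eqI)
    fix i
    have "real_of_int (fnum 1 m (int i) (int d - int i)) = fnum 1 m (real i) (real d - real i)"
      using fnum_of_int[of 1 m "int i" "int d - int i", where 'a = real] by simp
    thus "coeff (Poly (map real_of_int ?P)) i = coeff (smult ?K (binomial_poly d (f_seq m d))) i"
      using len nth[of i] m
      by (simp add: coeff_Poly_eq nth_default_def coeff_binomial_poly f_seq_eq_fnum
          del: coeff_list.simps)
  qed
  with rs(4) have "smult ?K (binomial_poly d (f_seq m d)) = smult c (\<Prod>r\<leftarrow>rs. [:r, 1:])"
    by simp
  hence "smult (1 / ?K) (smult ?K (binomial_poly d (f_seq m d)))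
      = smult (1 / ?K) (smult c (\<Prod>r\<leftarrow>rs. [:r, 1:]))" by (rule arg_cong)
  hence "binomial_poly d (f_seq m d) = smult (c / ?K) (\<Prod>r\<leftarrow>rs. [:r, 1:])"
    by simp
  thus ?thesis
    by (rule n_sequence_if_binomial_poly_splits) (use rs len in auto)
qed

lemma small_ok_imp_n_sequence:
  assumes "small_ok m d pss" "k < length pss" "m > 0"
  shows "n_sequence (d + k) (f_seq m (d + k))"
  using assms
proof (induction pss arbitrary: d k)
  case (Cons ps pss)
  show ?case
  proof (cases k)
    case 0
    thus ?thesis using Cons.prems n_sequence_if_splits_ok by (simp del: coeff_list.simps) blast
  next
    case (Suc k')
    thus ?thesis using Cons.IH[of "Suc d" k'] Cons.prems by simp
  qed
qed simp

section \<open>Separating points for all \<open>d\<close> below the threshold\<close>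

text \<open>In this and the following tables the lists belong to \<open>d = 1, 2, ...\<close> in
  turn. The points \<open>- p / q\<close> separate the zeros left after division by powers of
  \<open>1 + t\<close>, so there are \<open>min d (2 * m - 2) - 1\<close> of them.\<close>

definition points_3 :: "(int \<times> int) list list" where
  "points_3 = [[]]"

lemma small_ok_3: "small_ok 3 1 points_3"
  by code_simp

definition points_4 :: "(int \<times> int) list list" where
  "points_4 = [[],
    [(1, 1)],
    [(1, 2), (1, 1)]]"

lemma small_ok_4: "small_ok 4 1 points_4"
  by code_simp

definition points_5 :: "(int \<times> int) list list" where
  "points_5 = [[],
    [(1, 1)],
    [(1, 2), (1, 1)],
    [(1, 3), (1, 1), (2, 1)],
    [(1, 4), (1, 2), (1, 1), (2, 1)]]"

lemma small_ok_5: "small_ok 5 1 points_5"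
  by code_simp

definition points_6 :: "(int \<times> int) list list" where
  "points_6 = [[],
    [(1, 1)],
    [(1, 2), (1, 1)],
    [(1, 3), (1, 1), (2, 1)],
    [(1, 4), (1, 2), (1, 1), (2, 1)],
    [(1, 5), (1, 2), (1, 1), (2, 1), (3, 1)],
    [(1, 6), (1, 2), (2, 3), (1, 1), (2, 1), (3, 1)],
    [(1, 7), (1, 3), (1, 2), (1, 1), (3, 2), (2, 1), (3, 1)]]"

lemma small_ok_6: "small_ok 6 1 points_6"
  by code_simp

definition points_7 :: "(int \<times> int) list list" where
  "points_7 = [[],
    [(1, 2)],
    [(1, 2), (1, 1)],
    [(1, 3), (1, 1), (2, 1)],
    [(1, 5), (1, 2), (1, 1), (2, 1)],
    [(1, 6), (1, 2), (1, 1), (2, 1), (3, 1)],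
    [(1, 7), (1, 3), (1, 2), (1, 1), (2, 1), (3, 1)],
    [(1, 8), (1, 3), (1, 2), (1, 1), (3, 2), (2, 1), (4, 1)],
    [(1, 10), (1, 3), (1, 2), (2, 3), (1, 1), (3, 2), (2, 1), (4, 1)],
    [(1, 11), (1, 4), (1, 2), (2, 3), (1, 1), (4, 3), (2, 1), (3, 1), (4, 1)]]"

lemma small_ok_7: "small_ok 7 1 points_7"
  by code_simp

definition points_8 :: "(int \<times> int) list list" where
  "points_8 = [[],
    [(1, 2)],
    [(1, 3), (1, 1)],
    [(1, 4), (1, 1), (2, 1)],
    [(1, 5), (1, 2), (1, 1), (2, 1)],
    [(1, 6), (1, 2), (1, 1), (2, 1), (3, 1)],
    [(1, 8), (1, 3), (1, 2), (1, 1), (2, 1), (3, 1)],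
    [(1, 9), (1, 3), (1, 2), (1, 1), (3, 2), (2, 1), (4, 1)],
    [(1, 11), (1, 4), (1, 2), (2, 3), (1, 1), (3, 2), (2, 1), (4, 1)],
    [(1, 12), (1, 4), (1, 2), (2, 3), (1, 1), (4, 3), (2, 1), (3, 1), (5, 1)],
    [(1, 14), (1, 5), (1, 3), (1, 2), (3, 4), (1, 1), (3, 2), (2, 1), (3, 1), (5, 1)],
    [(1, 15), (1, 5), (1, 3), (1, 2), (2, 3), (1, 1), (5, 4), (3, 2), (2, 1), (3, 1), (6, 1)],
    [(1, 17), (1, 6), (1, 3), (1, 2), (2, 3), (5, 6), (1, 1), (4, 3), (3, 2), (2, 1), (4, 1), (6, 1)],
    [(1, 19), (1, 6), (1, 3), (1, 2), (2, 3), (4, 5), (1, 1), (7, 6), (4, 3), (2, 1), (3, 1), (4, 1), (7, 1)]]"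

lemma small_ok_8: "small_ok 8 1 points_8"
  by code_simp

definition points_9 :: "(int \<times> int) list list" where
  "points_9 = [[],
    [(1, 2)],
    [(1, 3), (1, 1)],
    [(1, 4), (1, 1), (2, 1)],
    [(1, 5), (1, 2), (1, 1), (2, 1)],
    [(1, 7), (1, 2), (1, 1), (2, 1), (3, 1)],
    [(1, 8), (1, 3), (1, 2), (1, 1), (2, 1), (3, 1)],
    [(1, 10), (1, 3), (1, 2), (1, 1), (3, 2), (2, 1), (4, 1)],
    [(1, 12), (1, 4), (1, 2), (2, 3), (1, 1), (2, 1), (3, 1), (4, 1)],
    [(1, 13), (1, 4), (1, 3), (1, 2), (1, 1), (4, 3), (2, 1), (3, 1), (5, 1)],
    [(1, 15), (1, 5), (1, 3), (1, 2), (3, 4), (1, 1), (3, 2), (2, 1), (3, 1), (6, 1)],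
    [(1, 17), (1, 6), (1, 3), (1, 2), (2, 3), (1, 1), (5, 4), (3, 2), (2, 1), (3, 1), (6, 1)],
    [(1, 19), (1, 6), (1, 3), (1, 2), (2, 3), (4, 5), (1, 1), (4, 3), (2, 1), (3, 1), (4, 1), (7, 1)],
    [(1, 21), (1, 7), (1, 4), (1, 2), (2, 3), (3, 4), (1, 1), (6, 5), (3, 2), (2, 1), (3, 1), (4, 1), (7, 1)],
    [(1, 22), (1, 7), (1, 4), (1, 3), (1, 2), (3, 4), (6, 7), (1, 1), (5, 4), (3, 2), (2, 1), (3, 1), (4, 1), (8, 1)],
    [(1, 24), (1, 8), (1, 4), (1, 3), (1, 2), (2, 3), (5, 6), (1, 1), (8, 7), (4, 3), (3, 2), (2, 1), (3, 1), (5, 1), (9, 1)],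
    [(1, 26), (1, 8), (1, 4), (1, 3), (1, 2), (2, 3), (4, 5), (1, 1), (6, 5), (4, 3), (3, 2), (2, 1), (3, 1), (5, 1), (9, 1)]]"

lemma small_ok_9: "small_ok 9 1 points_9"
  by code_simp

definition points_10 :: "(int \<times> int) list list" where
  "points_10 = [[],
    [(1, 2)],
    [(1, 3), (1, 1)],
    [(1, 4), (1, 2), (1, 1)],
    [(1, 6), (1, 2), (1, 1), (2, 1)],
    [(1, 7), (1, 3), (1, 1), (2, 1), (3, 1)],
    [(1, 9), (1, 3), (1, 2), (1, 1), (2, 1), (3, 1)],
    [(1, 11), (1, 4), (1, 2), (1, 1), (3, 2), (2, 1), (4, 1)],
    [(1, 12), (1, 4), (1, 2), (2, 3), (1, 1), (2, 1), (3, 1), (4, 1)],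
    [(1, 14), (1, 5), (1, 3), (1, 2), (1, 1), (4, 3), (2, 1), (3, 1), (5, 1)],
    [(1, 16), (1, 5), (1, 3), (1, 2), (2, 3), (1, 1), (3, 2), (2, 1), (3, 1), (6, 1)],
    [(1, 18), (1, 6), (1, 3), (1, 2), (2, 3), (1, 1), (4, 3), (3, 2), (2, 1), (4, 1), (6, 1)],
    [(1, 20), (1, 7), (1, 4), (1, 2), (2, 3), (3, 4), (1, 1), (4, 3), (2, 1), (3, 1), (4, 1), (7, 1)],
    [(1, 22), (1, 7), (1, 4), (1, 3), (1, 2), (3, 4), (1, 1), (5, 4), (3, 2), (2, 1), (3, 1), (4, 1), (8, 1)],
    [(1, 24), (1, 8), (1, 4), (1, 3), (1, 2), (2, 3), (5, 6), (1, 1), (4, 3), (3, 2), (2, 1), (3, 1), (5, 1), (8, 1)],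
    [(1, 26), (1, 8), (1, 4), (1, 3), (1, 2), (2, 3), (4, 5), (1, 1), (7, 6), (4, 3), (3, 2), (2, 1), (3, 1), (5, 1), (9, 1)],
    [(1, 28), (1, 9), (1, 5), (1, 3), (1, 2), (2, 3), (3, 4), (8, 9), (1, 1), (5, 4), (3, 2), (2, 1), (5, 2), (3, 1), (5, 1), (10, 1)],
    [(1, 31), (1, 10), (1, 5), (1, 3), (1, 2), (2, 3), (3, 4), (6, 7), (1, 1), (9, 8), (5, 4), (3, 2), (2, 1), (3, 1), (4, 1), (6, 1), (11, 1)],
    [(1, 33), (1, 10), (1, 5), (1, 3), (2, 5), (1, 2), (2, 3), (4, 5), (1, 1), (7, 6), (4, 3), (3, 2), (2, 1), (3, 1), (4, 1), (6, 1), (11, 1)],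
    [(1, 35), (1, 11), (1, 6), (1, 4), (1, 3), (1, 2), (2, 3), (4, 5), (1, 1), (6, 5), (4, 3), (3, 2), (2, 1), (3, 1), (4, 1), (6, 1), (12, 1)],
    [(1, 37), (1, 12), (1, 6), (1, 4), (1, 3), (1, 2), (2, 3), (3, 4), (1, 1), (5, 4), (3, 2), (5, 3), (2, 1), (3, 1), (4, 1), (7, 1), (13, 1)]]"

lemma small_ok_10: "small_ok 10 1 points_10"
  by code_simp

definition points_11 :: "(int \<times> int) list list" where
  "points_11 = [[],
    [(1, 2)],
    [(1, 3), (1, 1)],
    [(1, 4), (1, 2), (1, 1)],
    [(1, 6), (1, 2), (1, 1), (2, 1)],
    [(1, 7), (1, 3), (1, 1), (2, 1), (3, 1)],
    [(1, 9), (1, 3), (1, 2), (1, 1), (2, 1), (3, 1)],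
    [(1, 11), (1, 4), (1, 2), (1, 1), (3, 2), (2, 1), (4, 1)],
    [(1, 13), (1, 4), (1, 2), (2, 3), (1, 1), (2, 1), (3, 1), (5, 1)],
    [(1, 15), (1, 5), (1, 3), (1, 2), (1, 1), (3, 2), (2, 1), (3, 1), (5, 1)],
    [(1, 17), (1, 6), (1, 3), (1, 2), (2, 3), (1, 1), (3, 2), (2, 1), (3, 1), (6, 1)],
    [(1, 19), (1, 6), (1, 3), (1, 2), (2, 3), (1, 1), (4, 3), (3, 2), (2, 1), (4, 1), (7, 1)],
    [(1, 21), (1, 7), (1, 4), (1, 2), (2, 3), (3, 4), (1, 1), (3, 2), (2, 1), (3, 1), (4, 1), (7, 1)],
    [(1, 24), (1, 8), (1, 4), (1, 3), (1, 2), (2, 3), (1, 1), (5, 4), (3, 2), (2, 1), (3, 1), (4, 1), (8, 1)],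
    [(1, 26), (1, 8), (1, 4), (1, 3), (1, 2), (2, 3), (4, 5), (1, 1), (4, 3), (3, 2), (2, 1), (3, 1), (5, 1), (9, 1)],
    [(1, 28), (1, 9), (1, 5), (1, 3), (1, 2), (2, 3), (3, 4), (1, 1), (6, 5), (4, 3), (5, 3), (2, 1), (3, 1), (5, 1), (10, 1)],
    [(1, 30), (1, 10), (1, 5), (1, 3), (1, 2), (2, 3), (3, 4), (6, 7), (1, 1), (5, 4), (3, 2), (2, 1), (3, 1), (4, 1), (6, 1), (10, 1)],
    [(1, 33), (1, 10), (1, 5), (1, 3), (2, 5), (1, 2), (2, 3), (5, 6), (1, 1), (8, 7), (4, 3), (3, 2), (2, 1), (3, 1), (4, 1), (6, 1), (11, 1)],
    [(1, 35), (1, 11), (1, 6), (1, 4), (1, 3), (1, 2), (2, 3), (4, 5), (10, 11), (1, 1), (6, 5), (4, 3), (3, 2), (2, 1), (3, 1), (4, 1), (6, 1), (12, 1)],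
    [(1, 38), (1, 12), (1, 6), (1, 4), (1, 3), (1, 2), (2, 3), (3, 4), (7, 8), (1, 1), (11, 10), (5, 4), (3, 2), (5, 3), (2, 1), (3, 1), (4, 1), (7, 1), (13, 1)],
    [(1, 40), (1, 13), (1, 6), (1, 4), (1, 3), (1, 2), (2, 3), (3, 4), (5, 6), (1, 1), (8, 7), (5, 4), (3, 2), (2, 1), (5, 2), (3, 1), (4, 1), (7, 1), (13, 1)],
    [(1, 43), (1, 13), (1, 7), (1, 4), (1, 3), (1, 2), (3, 5), (3, 4), (4, 5), (1, 1), (7, 6), (4, 3), (3, 2), (2, 1), (5, 2), (3, 1), (5, 1), (7, 1), (14, 1)],
    [(1, 45), (1, 14), (1, 7), (1, 4), (1, 3), (1, 2), (3, 5), (2, 3), (4, 5), (1, 1), (6, 5), (4, 3), (3, 2), (2, 1), (5, 2), (4, 1), (5, 1), (8, 1), (15, 1)],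
    [(1, 47), (1, 15), (1, 7), (1, 5), (1, 3), (2, 5), (1, 2), (2, 3), (3, 4), (1, 1), (5, 4), (4, 3), (3, 2), (2, 1), (3, 1), (4, 1), (5, 1), (8, 1), (16, 1)],
    [(1, 50), (1, 15), (1, 8), (1, 5), (1, 3), (2, 5), (1, 2), (2, 3), (3, 4), (1, 1), (5, 4), (3, 2), (5, 3), (2, 1), (3, 1), (4, 1), (5, 1), (9, 1), (17, 1)]]"

lemma small_ok_11: "small_ok 11 1 points_11"
  by code_simp

definition points_12 :: "(int \<times> int) list list" where
  "points_12 = [[],
    [(1, 2)],
    [(1, 3), (1, 1)],
    [(1, 4), (1, 2), (1, 1)],
    [(1, 6), (1, 2), (1, 1), (2, 1)],
    [(1, 8), (1, 3), (1, 1), (2, 1), (3, 1)],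
    [(1, 10), (1, 3), (1, 2), (1, 1), (2, 1), (3, 1)],
    [(1, 11), (1, 4), (1, 2), (1, 1), (3, 2), (2, 1), (4, 1)],
    [(1, 13), (1, 4), (1, 2), (2, 3), (1, 1), (2, 1), (3, 1), (5, 1)],
    [(1, 16), (1, 5), (1, 3), (1, 2), (1, 1), (3, 2), (2, 1), (3, 1), (5, 1)],
    [(1, 18), (1, 6), (1, 3), (1, 2), (2, 3), (1, 1), (3, 2), (2, 1), (3, 1), (6, 1)],
    [(1, 20), (1, 7), (1, 3), (1, 2), (2, 3), (1, 1), (4, 3), (2, 1), (3, 1), (4, 1), (7, 1)],
    [(1, 23), (1, 7), (1, 4), (1, 3), (1, 2), (3, 4), (1, 1), (3, 2), (2, 1), (3, 1), (4, 1), (8, 1)],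
    [(1, 25), (1, 8), (1, 4), (1, 3), (1, 2), (2, 3), (1, 1), (5, 4), (3, 2), (2, 1), (3, 1), (5, 1), (8, 1)],
    [(1, 27), (1, 9), (1, 5), (1, 3), (1, 2), (2, 3), (4, 5), (1, 1), (4, 3), (3, 2), (2, 1), (3, 1), (5, 1), (9, 1)],
    [(1, 30), (1, 10), (1, 5), (1, 3), (1, 2), (2, 3), (3, 4), (1, 1), (6, 5), (3, 2), (2, 1), (5, 2), (3, 1), (5, 1), (10, 1)],
    [(1, 32), (1, 10), (1, 5), (1, 3), (1, 2), (3, 5), (3, 4), (5, 6), (1, 1), (5, 4), (3, 2), (2, 1), (3, 1), (4, 1), (6, 1), (11, 1)],
    [(1, 35), (1, 11), (1, 6), (1, 4), (1, 3), (1, 2), (2, 3), (4, 5), (1, 1), (7, 6), (4, 3), (3, 2), (2, 1), (3, 1), (4, 1), (6, 1), (12, 1)],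
    [(1, 38), (1, 12), (1, 6), (1, 4), (1, 3), (1, 2), (2, 3), (3, 4), (7, 8), (1, 1), (6, 5), (4, 3), (5, 3), (2, 1), (3, 1), (4, 1), (7, 1), (13, 1)],
    [(1, 40), (1, 13), (1, 6), (1, 4), (1, 3), (1, 2), (2, 3), (3, 4), (6, 7), (1, 1), (9, 8), (5, 4), (3, 2), (5, 3), (2, 1), (3, 1), (4, 1), (7, 1), (13, 1)],
    [(1, 43), (1, 13), (1, 7), (1, 4), (1, 3), (1, 2), (3, 5), (3, 4), (4, 5), (12, 13), (1, 1), (7, 6), (4, 3), (3, 2), (2, 1), (5, 2), (3, 1), (5, 1), (7, 1), (14, 1)],
    [(1, 46), (1, 14), (1, 7), (1, 4), (1, 3), (2, 5), (1, 2), (2, 3), (4, 5), (8, 9), (1, 1), (13, 12), (6, 5), (4, 3), (3, 2), (2, 1), (5, 2), (4, 1), (5, 1), (8, 1), (15, 1)],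
    [(1, 48), (1, 15), (1, 7), (1, 5), (1, 3), (2, 5), (1, 2), (2, 3), (3, 4), (6, 7), (1, 1), (9, 8), (5, 4), (4, 3), (5, 3), (2, 1), (3, 1), (4, 1), (5, 1), (8, 1), (16, 1)],
    [(1, 51), (1, 16), (1, 8), (1, 5), (1, 4), (2, 5), (1, 2), (2, 3), (3, 4), (5, 6), (1, 1), (8, 7), (5, 4), (3, 2), (5, 3), (2, 1), (3, 1), (4, 1), (5, 1), (9, 1), (17, 1)],
    [(1, 53), (1, 16), (1, 8), (1, 5), (1, 4), (1, 3), (1, 2), (2, 3), (3, 4), (4, 5), (1, 1), (7, 6), (4, 3), (3, 2), (5, 3), (2, 1), (3, 1), (4, 1), (6, 1), (9, 1), (18, 1)],
    [(1, 56), (1, 17), (1, 9), (1, 5), (1, 4), (1, 3), (1, 2), (3, 5), (2, 3), (4, 5), (1, 1), (6, 5), (4, 3), (3, 2), (2, 1), (5, 2), (3, 1), (4, 1), (6, 1), (10, 1), (19, 1)],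
    [(1, 59), (1, 18), (1, 9), (1, 6), (1, 4), (1, 3), (1, 2), (3, 5), (2, 3), (4, 5), (1, 1), (5, 4), (4, 3), (3, 2), (2, 1), (5, 2), (3, 1), (4, 1), (6, 1), (10, 1), (20, 1)],
    [(1, 62), (1, 19), (1, 9), (1, 6), (1, 4), (1, 3), (2, 5), (1, 2), (2, 3), (3, 4), (1, 1), (5, 4), (4, 3), (5, 3), (2, 1), (5, 2), (3, 1), (4, 1), (6, 1), (10, 1), (20, 1)]]"

lemma small_ok_12: "small_ok 12 1 points_12"
  by code_simp

definition points_13 :: "(int \<times> int) list list" where
  "points_13 = [[],
    [(1, 2)],
    [(1, 3), (1, 1)],
    [(1, 4), (1, 2), (1, 1)],
    [(1, 6), (1, 2), (1, 1), (2, 1)],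
    [(1, 8), (1, 3), (1, 1), (2, 1), (3, 1)],
    [(1, 10), (1, 3), (1, 2), (1, 1), (2, 1), (3, 1)],
    [(1, 12), (1, 4), (1, 2), (1, 1), (3, 2), (2, 1), (4, 1)],
    [(1, 14), (1, 5), (1, 3), (1, 2), (1, 1), (2, 1), (3, 1), (5, 1)],
    [(1, 16), (1, 5), (1, 3), (1, 2), (1, 1), (3, 2), (2, 1), (3, 1), (6, 1)],
    [(1, 19), (1, 6), (1, 3), (1, 2), (2, 3), (1, 1), (3, 2), (2, 1), (3, 1), (6, 1)],
    [(1, 21), (1, 7), (1, 4), (1, 2), (2, 3), (1, 1), (4, 3), (2, 1), (3, 1), (4, 1), (7, 1)],
    [(1, 24), (1, 8), (1, 4), (1, 3), (1, 2), (3, 4), (1, 1), (3, 2), (2, 1), (3, 1), (4, 1), (8, 1)],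
    [(1, 26), (1, 8), (1, 4), (1, 3), (1, 2), (2, 3), (1, 1), (5, 4), (3, 2), (2, 1), (3, 1), (5, 1), (9, 1)],
    [(1, 29), (1, 9), (1, 5), (1, 3), (1, 2), (2, 3), (4, 5), (1, 1), (4, 3), (3, 2), (2, 1), (3, 1), (5, 1), (10, 1)],
    [(1, 31), (1, 10), (1, 5), (1, 3), (1, 2), (2, 3), (3, 4), (1, 1), (5, 4), (3, 2), (2, 1), (3, 1), (4, 1), (6, 1), (11, 1)],
    [(1, 34), (1, 11), (1, 6), (1, 4), (2, 5), (1, 2), (2, 3), (5, 6), (1, 1), (4, 3), (3, 2), (2, 1), (3, 1), (4, 1), (6, 1), (11, 1)],
    [(1, 37), (1, 12), (1, 6), (1, 4), (1, 3), (1, 2), (2, 3), (4, 5), (1, 1), (7, 6), (4, 3), (3, 2), (2, 1), (3, 1), (4, 1), (6, 1), (12, 1)],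
    [(1, 40), (1, 12), (1, 6), (1, 4), (1, 3), (1, 2), (2, 3), (3, 4), (6, 7), (1, 1), (5, 4), (3, 2), (5, 3), (2, 1), (3, 1), (4, 1), (7, 1), (13, 1)],
    [(1, 43), (1, 13), (1, 7), (1, 4), (1, 3), (1, 2), (3, 5), (3, 4), (5, 6), (1, 1), (8, 7), (4, 3), (3, 2), (2, 1), (5, 2), (3, 1), (5, 1), (7, 1), (14, 1)],
    [(1, 45), (1, 14), (1, 7), (1, 4), (1, 3), (1, 2), (3, 5), (2, 3), (4, 5), (8, 9), (1, 1), (6, 5), (4, 3), (3, 2), (2, 1), (5, 2), (3, 1), (5, 1), (8, 1), (15, 1)],
    [(1, 48), (1, 15), (1, 7), (1, 5), (1, 3), (2, 5), (1, 2), (2, 3), (3, 4), (6, 7), (1, 1), (11, 10), (5, 4), (4, 3), (3, 2), (2, 1), (3, 1), (4, 1), (5, 1), (8, 1), (16, 1)],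
    [(1, 51), (1, 16), (1, 8), (1, 5), (1, 4), (2, 5), (1, 2), (2, 3), (3, 4), (5, 6), (14, 15), (1, 1), (8, 7), (5, 4), (3, 2), (5, 3), (2, 1), (3, 1), (4, 1), (5, 1), (9, 1), (17, 1)],
    [(1, 54), (1, 17), (1, 8), (1, 5), (1, 4), (1, 3), (1, 2), (2, 3), (3, 4), (4, 5), (10, 11), (1, 1), (15, 14), (7, 6), (4, 3), (3, 2), (5, 3), (2, 1), (3, 1), (4, 1), (6, 1), (9, 1), (18, 1)],
    [(1, 57), (1, 18), (1, 9), (1, 5), (1, 4), (1, 3), (1, 2), (3, 5), (2, 3), (4, 5), (7, 8), (1, 1), (11, 10), (6, 5), (4, 3), (3, 2), (2, 1), (5, 2), (3, 1), (4, 1), (6, 1), (10, 1), (19, 1)],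
    [(1, 60), (1, 18), (1, 9), (1, 6), (1, 4), (1, 3), (1, 2), (3, 5), (2, 3), (3, 4), (6, 7), (1, 1), (9, 8), (5, 4), (4, 3), (3, 2), (2, 1), (5, 2), (3, 1), (4, 1), (6, 1), (10, 1), (20, 1)],
    [(1, 62), (1, 19), (1, 10), (1, 6), (1, 4), (1, 3), (2, 5), (1, 2), (2, 3), (3, 4), (5, 6), (1, 1), (7, 6), (5, 4), (3, 2), (5, 3), (2, 1), (5, 2), (3, 1), (4, 1), (6, 1), (10, 1), (21, 1)],
    [(1, 66), (1, 20), (1, 10), (1, 6), (1, 4), (1, 3), (2, 5), (1, 2), (2, 3), (3, 4), (4, 5), (1, 1), (7, 6), (4, 3), (3, 2), (5, 3), (2, 1), (5, 2), (4, 1), (5, 1), (7, 1), (11, 1), (21, 1)],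
    [(1, 69), (1, 21), (1, 10), (1, 6), (1, 4), (1, 3), (2, 5), (1, 2), (3, 5), (3, 4), (4, 5), (1, 1), (6, 5), (4, 3), (3, 2), (5, 3), (2, 1), (3, 1), (4, 1), (5, 1), (7, 1), (11, 1), (22, 1)],
    [(1, 72), (1, 22), (1, 11), (1, 7), (1, 5), (1, 3), (2, 5), (1, 2), (3, 5), (2, 3), (4, 5), (1, 1), (5, 4), (4, 3), (3, 2), (2, 1), (5, 2), (3, 1), (4, 1), (5, 1), (7, 1), (12, 1), (23, 1)],
    [(1, 75), (1, 23), (1, 11), (1, 7), (1, 5), (1, 4), (1, 3), (1, 2), (3, 5), (2, 3), (3, 4), (1, 1), (5, 4), (4, 3), (3, 2), (2, 1), (5, 2), (3, 1), (4, 1), (5, 1), (7, 1), (12, 1), (24, 1)],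
    [(1, 78), (1, 24), (1, 12), (1, 7), (1, 5), (1, 4), (1, 3), (1, 2), (3, 5), (2, 3), (3, 4), (1, 1), (5, 4), (3, 2), (5, 3), (2, 1), (5, 2), (3, 1), (4, 1), (5, 1), (8, 1), (13, 1), (25, 1)]]"

lemma small_ok_13: "small_ok 13 1 points_13"
  by code_simp

definition points_14 :: "(int \<times> int) list list" where
  "points_14 = [[],
    [(1, 2)],
    [(1, 3), (1, 1)],
    [(1, 5), (1, 2), (1, 1)],
    [(1, 6), (1, 2), (1, 1), (2, 1)],
    [(1, 8), (1, 3), (1, 1), (2, 1), (3, 1)],
    [(1, 10), (1, 3), (1, 2), (1, 1), (2, 1), (3, 1)],
    [(1, 12), (1, 4), (1, 2), (1, 1), (3, 2), (2, 1), (4, 1)],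
    [(1, 15), (1, 5), (1, 3), (1, 2), (1, 1), (2, 1), (3, 1), (5, 1)],
    [(1, 17), (1, 6), (1, 3), (1, 2), (1, 1), (3, 2), (2, 1), (3, 1), (6, 1)],
    [(1, 20), (1, 6), (1, 3), (1, 2), (2, 3), (1, 1), (3, 2), (2, 1), (4, 1), (6, 1)],
    [(1, 22), (1, 7), (1, 4), (1, 2), (2, 3), (1, 1), (4, 3), (2, 1), (3, 1), (4, 1), (7, 1)],
    [(1, 25), (1, 8), (1, 4), (1, 3), (1, 2), (3, 4), (1, 1), (3, 2), (2, 1), (3, 1), (4, 1), (8, 1)],
    [(1, 27), (1, 9), (1, 4), (1, 3), (1, 2), (2, 3), (1, 1), (4, 3), (3, 2), (2, 1), (3, 1), (5, 1), (9, 1)],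
    [(1, 30), (1, 10), (1, 5), (1, 3), (1, 2), (2, 3), (3, 4), (1, 1), (4, 3), (3, 2), (2, 1), (3, 1), (5, 1), (10, 1)],
    [(1, 33), (1, 10), (1, 5), (1, 3), (1, 2), (2, 3), (3, 4), (1, 1), (5, 4), (3, 2), (2, 1), (3, 1), (4, 1), (6, 1), (11, 1)],
    [(1, 36), (1, 11), (1, 6), (1, 4), (1, 3), (1, 2), (2, 3), (4, 5), (1, 1), (4, 3), (3, 2), (2, 1), (3, 1), (4, 1), (6, 1), (12, 1)],
    [(1, 39), (1, 12), (1, 6), (1, 4), (1, 3), (1, 2), (2, 3), (3, 4), (1, 1), (6, 5), (4, 3), (3, 2), (2, 1), (3, 1), (4, 1), (7, 1), (13, 1)],
    [(1, 42), (1, 13), (1, 7), (1, 4), (1, 3), (1, 2), (2, 3), (3, 4), (6, 7), (1, 1), (5, 4), (3, 2), (2, 1), (5, 2), (3, 1), (4, 1), (7, 1), (13, 1)],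
    [(1, 45), (1, 14), (1, 7), (1, 4), (1, 3), (1, 2), (3, 5), (2, 3), (4, 5), (1, 1), (7, 6), (4, 3), (3, 2), (2, 1), (5, 2), (3, 1), (5, 1), (7, 1), (14, 1)],
    [(1, 47), (1, 15), (1, 7), (1, 5), (1, 3), (2, 5), (1, 2), (2, 3), (4, 5), (7, 8), (1, 1), (6, 5), (4, 3), (3, 2), (2, 1), (3, 1), (4, 1), (5, 1), (8, 1), (15, 1)],
    [(1, 51), (1, 16), (1, 8), (1, 5), (1, 3), (2, 5), (1, 2), (2, 3), (3, 4), (6, 7), (1, 1), (9, 8), (5, 4), (3, 2), (5, 3), (2, 1), (3, 1), (4, 1), (5, 1), (8, 1), (16, 1)],
    [(1, 53), (1, 16), (1, 8), (1, 5), (1, 4), (1, 3), (1, 2), (2, 3), (3, 4), (4, 5), (10, 11), (1, 1), (7, 6), (4, 3), (3, 2), (5, 3), (2, 1), (3, 1), (4, 1), (6, 1), (9, 1), (17, 1)],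
    [(1, 57), (1, 18), (1, 9), (1, 5), (1, 4), (1, 3), (1, 2), (3, 5), (2, 3), (4, 5), (7, 8), (1, 1), (13, 12), (6, 5), (4, 3), (3, 2), (2, 1), (5, 2), (3, 1), (4, 1), (6, 1), (9, 1), (18, 1)],
    [(1, 60), (1, 19), (1, 9), (1, 6), (1, 4), (1, 3), (1, 2), (3, 5), (2, 3), (3, 4), (6, 7), (14, 15), (1, 1), (9, 8), (5, 4), (4, 3), (3, 2), (2, 1), (5, 2), (3, 1), (4, 1), (6, 1), (10, 1), (19, 1)],
    [(1, 63), (1, 20), (1, 10), (1, 6), (1, 4), (1, 3), (2, 5), (1, 2), (2, 3), (3, 4), (5, 6), (12, 13), (1, 1), (15, 14), (7, 6), (5, 4), (3, 2), (5, 3), (2, 1), (5, 2), (3, 1), (4, 1), (6, 1), (10, 1), (20, 1)],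
    [(1, 67), (1, 20), (1, 10), (1, 6), (1, 4), (1, 3), (2, 5), (1, 2), (2, 3), (3, 4), (4, 5), (8, 9), (1, 1), (13, 12), (6, 5), (4, 3), (3, 2), (5, 3), (2, 1), (3, 1), (4, 1), (5, 1), (7, 1), (11, 1), (21, 1)],
    [(1, 69), (1, 21), (1, 11), (1, 6), (1, 4), (1, 3), (2, 5), (1, 2), (3, 5), (3, 4), (4, 5), (7, 8), (1, 1), (9, 8), (6, 5), (4, 3), (3, 2), (5, 3), (2, 1), (3, 1), (4, 1), (5, 1), (7, 1), (11, 1), (22, 1)],
    [(1, 73), (1, 22), (1, 11), (1, 7), (1, 5), (1, 4), (2, 5), (1, 2), (3, 5), (2, 3), (3, 4), (6, 7), (1, 1), (8, 7), (5, 4), (4, 3), (3, 2), (2, 1), (5, 2), (3, 1), (4, 1), (5, 1), (7, 1), (12, 1), (24, 1)],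
    [(1, 77), (1, 23), (1, 11), (1, 7), (1, 5), (1, 4), (1, 3), (1, 2), (3, 5), (2, 3), (3, 4), (5, 6), (1, 1), (7, 6), (5, 4), (4, 3), (5, 3), (2, 1), (5, 2), (3, 1), (4, 1), (5, 1), (8, 1), (12, 1), (24, 1)],
    [(1, 79), (1, 24), (1, 12), (1, 7), (1, 5), (1, 4), (1, 3), (3, 7), (1, 2), (2, 3), (3, 4), (5, 6), (1, 1), (7, 6), (4, 3), (3, 2), (5, 3), (2, 1), (5, 2), (3, 1), (4, 1), (5, 1), (8, 1), (13, 1), (26, 1)],
    [(1, 82), (1, 25), (1, 12), (1, 8), (1, 5), (1, 4), (1, 3), (2, 5), (1, 2), (2, 3), (3, 4), (4, 5), (1, 1), (6, 5), (4, 3), (3, 2), (5, 3), (2, 1), (5, 2), (3, 1), (4, 1), (6, 1), (8, 1), (13, 1), (26, 1)],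
    [(1, 86), (1, 26), (1, 13), (1, 8), (1, 5), (1, 4), (1, 3), (2, 5), (1, 2), (3, 5), (3, 4), (4, 5), (1, 1), (5, 4), (4, 3), (3, 2), (5, 3), (2, 1), (5, 2), (3, 1), (4, 1), (6, 1), (8, 1), (14, 1), (27, 1)],
    [(1, 89), (1, 27), (1, 13), (1, 8), (1, 6), (1, 4), (1, 3), (2, 5), (1, 2), (3, 5), (2, 3), (4, 5), (1, 1), (5, 4), (4, 3), (3, 2), (7, 4), (2, 1), (5, 2), (7, 2), (4, 1), (6, 1), (9, 1), (14, 1), (28, 1)],
    [(1, 93), (1, 28), (1, 14), (1, 8), (1, 6), (1, 4), (1, 3), (2, 5), (1, 2), (3, 5), (2, 3), (3, 4), (1, 1), (5, 4), (4, 3), (3, 2), (2, 1), (7, 3), (3, 1), (4, 1), (5, 1), (6, 1), (9, 1), (15, 1), (29, 1)]]"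

lemma small_ok_14: "small_ok 14 1 points_14"
  by code_simp

definition points_15 :: "(int \<times> int) list list" where
  "points_15 = [[],
    [(1, 2)],
    [(1, 3), (1, 1)],
    [(1, 5), (1, 2), (1, 1)],
    [(1, 6), (1, 2), (1, 1), (2, 1)],
    [(1, 8), (1, 3), (1, 1), (2, 1), (3, 1)],
    [(1, 11), (1, 3), (1, 2), (1, 1), (2, 1), (3, 1)],
    [(1, 13), (1, 4), (1, 2), (1, 1), (3, 2), (2, 1), (4, 1)],
    [(1, 15), (1, 5), (1, 3), (1, 2), (1, 1), (2, 1), (3, 1), (5, 1)],
    [(1, 18), (1, 6), (1, 3), (1, 2), (1, 1), (3, 2), (2, 1), (3, 1), (6, 1)],
    [(1, 20), (1, 6), (1, 3), (1, 2), (2, 3), (1, 1), (3, 2), (2, 1), (4, 1), (7, 1)],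
    [(1, 23), (1, 7), (1, 4), (1, 2), (2, 3), (1, 1), (4, 3), (2, 1), (3, 1), (4, 1), (7, 1)],
    [(1, 26), (1, 8), (1, 4), (1, 3), (1, 2), (2, 3), (1, 1), (3, 2), (2, 1), (3, 1), (4, 1), (8, 1)],
    [(1, 28), (1, 9), (1, 5), (1, 3), (1, 2), (2, 3), (1, 1), (4, 3), (3, 2), (2, 1), (3, 1), (5, 1), (9, 1)],
    [(1, 31), (1, 10), (1, 5), (1, 3), (1, 2), (2, 3), (3, 4), (1, 1), (4, 3), (2, 1), (5, 2), (3, 1), (5, 1), (10, 1)],
    [(1, 34), (1, 11), (1, 6), (1, 4), (2, 5), (1, 2), (3, 4), (1, 1), (5, 4), (3, 2), (2, 1), (3, 1), (4, 1), (6, 1), (11, 1)],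
    [(1, 37), (1, 12), (1, 6), (1, 4), (1, 3), (1, 2), (2, 3), (4, 5), (1, 1), (4, 3), (3, 2), (2, 1), (3, 1), (4, 1), (6, 1), (12, 1)],
    [(1, 41), (1, 13), (1, 6), (1, 4), (1, 3), (1, 2), (2, 3), (3, 4), (1, 1), (6, 5), (4, 3), (5, 3), (2, 1), (3, 1), (4, 1), (7, 1), (13, 1)],
    [(1, 43), (1, 13), (1, 7), (1, 4), (1, 3), (1, 2), (2, 3), (3, 4), (5, 6), (1, 1), (5, 4), (3, 2), (2, 1), (5, 2), (3, 1), (5, 1), (7, 1), (14, 1)],
    [(1, 47), (1, 14), (1, 7), (1, 5), (1, 3), (2, 5), (1, 2), (2, 3), (4, 5), (1, 1), (7, 6), (4, 3), (3, 2), (2, 1), (5, 2), (3, 1), (5, 1), (8, 1), (15, 1)],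
    [(1, 50), (1, 15), (1, 8), (1, 5), (1, 3), (2, 5), (1, 2), (2, 3), (3, 4), (6, 7), (1, 1), (5, 4), (4, 3), (3, 2), (2, 1), (3, 1), (4, 1), (5, 1), (8, 1), (16, 1)],
    [(1, 53), (1, 16), (1, 8), (1, 5), (1, 4), (1, 3), (1, 2), (2, 3), (3, 4), (5, 6), (1, 1), (8, 7), (5, 4), (3, 2), (5, 3), (2, 1), (3, 1), (4, 1), (6, 1), (9, 1), (17, 1)],
    [(1, 56), (1, 17), (1, 9), (1, 5), (1, 4), (1, 3), (1, 2), (3, 5), (2, 3), (4, 5), (8, 9), (1, 1), (7, 6), (4, 3), (3, 2), (2, 1), (5, 2), (3, 1), (4, 1), (6, 1), (9, 1), (18, 1)],
    [(1, 60), (1, 18), (1, 9), (1, 6), (1, 4), (1, 3), (1, 2), (3, 5), (2, 3), (3, 4), (6, 7), (1, 1), (11, 10), (5, 4), (4, 3), (3, 2), (2, 1), (5, 2), (3, 1), (4, 1), (6, 1), (10, 1), (19, 1)],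
    [(1, 63), (1, 19), (1, 10), (1, 6), (1, 4), (1, 3), (2, 5), (1, 2), (2, 3), (3, 4), (5, 6), (12, 13), (1, 1), (8, 7), (5, 4), (4, 3), (5, 3), (2, 1), (5, 2), (3, 1), (4, 1), (6, 1), (10, 1), (20, 1)],
    [(1, 67), (1, 20), (1, 10), (1, 6), (1, 4), (1, 3), (2, 5), (1, 2), (2, 3), (3, 4), (4, 5), (8, 9), (1, 1), (13, 12), (7, 6), (4, 3), (3, 2), (5, 3), (2, 1), (5, 2), (4, 1), (5, 1), (7, 1), (11, 1), (21, 1)],
    [(1, 70), (1, 21), (1, 11), (1, 6), (1, 4), (1, 3), (2, 5), (1, 2), (3, 5), (2, 3), (4, 5), (7, 8), (19, 20), (1, 1), (11, 10), (6, 5), (4, 3), (3, 2), (5, 3), (2, 1), (3, 1), (4, 1), (5, 1), (7, 1), (11, 1), (22, 1)],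
    [(1, 73), (1, 22), (1, 11), (1, 7), (1, 5), (1, 4), (2, 5), (1, 2), (3, 5), (2, 3), (3, 4), (6, 7), (12, 13), (1, 1), (20, 19), (8, 7), (5, 4), (4, 3), (3, 2), (2, 1), (5, 2), (3, 1), (4, 1), (5, 1), (7, 1), (12, 1), (23, 1)],
    [(1, 77), (1, 24), (1, 12), (1, 7), (1, 5), (1, 4), (1, 3), (1, 2), (3, 5), (2, 3), (3, 4), (5, 6), (10, 11), (1, 1), (13, 12), (7, 6), (5, 4), (7, 5), (5, 3), (2, 1), (5, 2), (3, 1), (4, 1), (5, 1), (8, 1), (12, 1), (24, 1)],
    [(1, 81), (1, 24), (1, 12), (1, 7), (1, 5), (1, 4), (1, 3), (2, 5), (1, 2), (2, 3), (3, 4), (4, 5), (8, 9), (1, 1), (11, 10), (6, 5), (4, 3), (3, 2), (5, 3), (2, 1), (5, 2), (3, 1), (4, 1), (5, 1), (8, 1), (13, 1), (26, 1)],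
    [(1, 83), (1, 26), (1, 12), (1, 8), (1, 5), (1, 4), (1, 3), (2, 5), (1, 2), (2, 3), (3, 4), (4, 5), (6, 7), (1, 1), (9, 8), (6, 5), (4, 3), (3, 2), (5, 3), (2, 1), (5, 2), (3, 1), (4, 1), (6, 1), (8, 1), (13, 1), (26, 1)],
    [(1, 86), (1, 26), (1, 13), (1, 8), (1, 5), (1, 4), (1, 3), (2, 5), (1, 2), (3, 5), (2, 3), (4, 5), (6, 7), (1, 1), (8, 7), (5, 4), (4, 3), (3, 2), (5, 3), (2, 1), (5, 2), (3, 1), (4, 1), (6, 1), (8, 1), (14, 1), (27, 1)],
    [(1, 91), (1, 27), (1, 13), (1, 8), (1, 6), (1, 4), (1, 3), (2, 5), (1, 2), (3, 5), (2, 3), (3, 4), (5, 6), (1, 1), (7, 6), (5, 4), (4, 3), (3, 2), (2, 1), (7, 3), (3, 1), (7, 2), (4, 1), (6, 1), (9, 1), (14, 1), (29, 1)],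
    [(1, 94), (1, 28), (1, 14), (1, 8), (1, 6), (1, 4), (1, 3), (2, 5), (1, 2), (3, 5), (2, 3), (3, 4), (5, 6), (1, 1), (7, 6), (5, 4), (7, 5), (5, 3), (2, 1), (5, 2), (3, 1), (4, 1), (5, 1), (6, 1), (9, 1), (15, 1), (30, 1)],
    [(1, 98), (1, 30), (1, 14), (1, 9), (1, 6), (1, 4), (2, 7), (2, 5), (1, 2), (4, 7), (2, 3), (3, 4), (4, 5), (1, 1), (6, 5), (4, 3), (3, 2), (5, 3), (2, 1), (5, 2), (3, 1), (4, 1), (5, 1), (6, 1), (9, 1), (15, 1), (31, 1)],
    [(1, 101), (1, 31), (1, 15), (1, 9), (1, 6), (1, 5), (1, 4), (1, 3), (3, 7), (1, 2), (2, 3), (3, 4), (4, 5), (1, 1), (5, 4), (4, 3), (3, 2), (5, 3), (2, 1), (5, 2), (3, 1), (4, 1), (5, 1), (7, 1), (10, 1), (16, 1), (32, 1)],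
    [(1, 104), (1, 32), (1, 15), (1, 9), (1, 6), (1, 5), (1, 4), (1, 3), (2, 5), (1, 2), (3, 5), (5, 7), (4, 5), (1, 1), (5, 4), (4, 3), (3, 2), (5, 3), (2, 1), (5, 2), (3, 1), (4, 1), (5, 1), (7, 1), (10, 1), (16, 1), (33, 1)],
    [(1, 108), (1, 32), (1, 16), (1, 10), (1, 7), (1, 5), (1, 4), (1, 3), (2, 5), (1, 2), (3, 5), (2, 3), (3, 4), (1, 1), (5, 4), (4, 3), (3, 2), (7, 4), (2, 1), (5, 2), (3, 1), (4, 1), (5, 1), (7, 1), (10, 1), (17, 1), (34, 1)],
    [(1, 112), (1, 34), (1, 16), (1, 10), (1, 7), (1, 5), (1, 4), (1, 3), (2, 5), (1, 2), (3, 5), (2, 3), (3, 4), (1, 1), (5, 4), (7, 5), (5, 3), (7, 4), (2, 1), (5, 2), (3, 1), (4, 1), (5, 1), (7, 1), (11, 1), (18, 1), (35, 1)]]"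

lemma small_ok_15: "small_ok 15 1 points_15"
  by code_simp

lemma n_sequence_below_threshold:
  assumes m: "3 \<le> m" "m \<le> 15" and d: "0 < d" "d < threshold m"
  shows "n_sequence d (f_seq m d)"
proof -
  have *: "\<exists>pss. small_ok m 1 pss \<and> length pss = threshold m - 1"
  proof -
    have "m = 3 \<or> m = 4 \<or> m = 5 \<or> m = 6 \<or> m = 7 \<or> m = 8 \<or> m = 9 \<or> m = 10
        \<or> m = 11 \<or> m = 12 \<or> m = 13 \<or> m = 14 \<or> m = 15"
      using m by presburger
    moreover have "length points_3 = threshold 3 - 1" "length points_4 = threshold 4 - 1"
      "length points_5 = threshold 5 - 1" "length points_6 = threshold 6 - 1"
      "length points_7 = threshold 7 - 1" "length points_8 = threshold 8 - 1"
      "length points_9 = threshold 9 - 1" "length points_10 = threshold 10 - 1"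
      "length points_11 = threshold 11 - 1" "length points_12 = threshold 12 - 1"
      "length points_13 = threshold 13 - 1" "length points_14 = threshold 14 - 1"
      "length points_15 = threshold 15 - 1"
      by code_simp+
    ultimately show ?thesis
      using small_ok_3 small_ok_4 small_ok_5 small_ok_6 small_ok_7 small_ok_8 small_ok_9
        small_ok_10 small_ok_11 small_ok_12 small_ok_13 small_ok_14 small_ok_15
      by blast
  qed
  then obtain pss where "small_ok m 1 pss" "length pss = threshold m - 1" by blast
  thus ?thesis
    using small_ok_imp_n_sequence[of m 1 pss "d - 1"] d m by simp
qed

section \<open>The case \<open>m = 2\<close> and the conclusion\<close>

text \<open>Here the polynomial is \<open>2 + (d - x) * (x + 2)\<close>. It is negative at -3 and
  positive at -2, so besides the zero beyond \<open>d\<close> it has one below -2, and the cofactor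
  is constant.\<close>

lemma n_sequence_two:
  assumes d: "d > 0"
  shows "n_sequence d (f_seq 2 d)"
proof -
  let ?P = "fpoly (real d) 2"
  obtain R1 where R1: "finite R1" "card R1 = 1" "\<And>r. r \<in> R1 \<Longrightarrow> poly ?P r = 0 \<and> real d < r"
    using fpoly_left_roots[of "real d" 2] d by auto
  have v: "poly ?P x = 2 + (real d - x) * (x + 2)" for x
    by (simp add: numeral_2_eq_2 algebra_simps)
  obtain s where s: "s < -2" "poly ?P s = 0"
    using poly_IVT_pos[of "-3" "-2" ?P] d unfolding v by auto
  have "s \<notin> R1" using R1(3) s by force
  define R where "R = insert s R1"
  have R: "finite R" "card R = 2" using R1 \<open>s \<notin> R1\<close> by (auto simp: R_def)
  obtain Q where Q: "?P = (\<Prod>r\<in>R. [:-r, 1:]) * Q"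
    using poly_factor_roots[of R ?P] R R1(3) s by (auto simp: R_def)
  have deg: "degree ?P = 2 \<and> lead_coeff ?P = -1"
    using fpoly_degree[of "real d" 1] by (simp only: numeral_2_eq_2) simp
  hence nz: "(\<Prod>r\<in>R. [:-r, 1:]) \<noteq> 0" "Q \<noteq> 0" using Q by auto
  have "degree (\<Prod>r\<in>R. [:-r, 1:]) = 2"
    using R by (subst degree_prod_eq_sum_degree) auto
  hence "degree Q = 0" using degree_mult_eq[OF nz] deg Q by simp
  then obtain c where c: "Q = [:c:]" by (auto elim: degree_eq_zeroE)
  show ?thesis
  proof (rule n_sequence_fpoly[OF Q R(1)])
    show "r < 0 \<or> real d < r" if "r \<in> R" for r using that R1(3) s by (auto simp: R_def)
    show "n_sequence d (\<lambda>i. poly Q (real d - real i))"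
      using nz c n_sequence_const[of c d] by simp
  qed (use d in auto)
qed

theorem theorem2p5:
  fixes d m :: nat
  assumes "d > 0" and "2 \<le> m" and "m \<le> 15"
  shows "n_sequence d (f_seq m d)"
proof (cases "m = 2")
  case False
  hence "3 \<le> m" using assms by simp
  thus ?thesis
    using n_sequence_above_threshold n_sequence_below_threshold assms by (cases "threshold m \<le> d") auto
qed (use n_sequence_two assms in simp)

end
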